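(* Let $0 < p < 1$ and $1 < c < 2$. Then for all sufficiently large $N$ there exists an $N$-dimensional bi-quadratic cooperative Boolean network that is both $p$-$c$-chaotic and $p$-unstable.
   Context: Write $[N]=\{1,\dots,N\}$. An $N$-dimensional Boolean network (or Boolean system) is a pair $(2^{[N]},f)$ with $f:\{0,1\}^{[N]}\to\{0,1\}^{[N]}$; it is updated synchronously in discrete time by $\vec{s}(t+1)=f(\vec{s}(t))$, $t=0,1,2,\dots$. The coordinate function $f_j$ is the regulatory function of variable $j$. An attractor is a periodic orbit of $f$ (including fixed points); its length is the number of states in it. Every trajectory eventually enters exactly one attractor, and the basin of attraction of an attractor is the set of initial states whose trajectories reach it. The network is cooperative if $\vec{s}\le\vec{s}^{\,*}$ coordinatewise implies $f(\vec{s})\le f(\vec{s}^{\,*})$ coordinatewise. The indegree of variable $j$ is the number of variables from which $f_j$ takes input (i.e. on which $f_j$ depends; $j$ itself is allowed); the outdegree of variable $i$ is the number of variables $j$ such that $f_j$ takes input from $i$. The network is bi-quadratic if every variable has indegree at most $2$ and outdegree at most $2$. A randomly chosen initial condition is uniformly distributed on $\{0,1\}^{[N]}$; a random single-bit flip changes the value of one coordinate chosen uniformly from $[N]$, independently of the state. The network is $p$-$c$-chaotic if with probability $>p$ the trajectory of a randomly chosen initial condition reaches an attractor of length $>c^N$. It is $p$-unstable if a random single-bit flip in a randomly chosen initial state moves the trajectory into the basin of attraction of a different attractor with probability at least $p$. *)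

theory Defs
  imports "HOL-Probability.Probability"
begin

text \<open>
  States of an \<open>N\<close>-dimensional network are functions from \<open>{1..N}\<close> to \<open>bool\<close>,
  extensional outside \<open>{1..N}\<close> so that there are exactly \<open>2 ^ N\<close> of them.
  The order on \<open>bool\<close> is \<open>False < True\<close>.
\<close>

type_synonym state = "nat \<Rightarrow> bool"

definition states :: "nat \<Rightarrow> state set" where
  "states N = ({1..N} \<rightarrow>\<^sub>E UNIV)"

definition boolean_network :: "nat \<Rightarrow> (state \<Rightarrow> state) \<Rightarrow> bool" where
  "boolean_network N f \<longleftrightarrow> f \<in> states N \<rightarrow> states N"

definition flip :: "nat \<Rightarrow> state \<Rightarrow> state" where
  "flip i s = s(i := \<not> s i)"

lemma finite_states: "finite (states N)"
  unfolding states_def by (intro finite_PiE) auto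

lemma card_states: "card (states N) = 2 ^ N"
  unfolding states_def by (simp add: card_PiE)

lemma flip_in_states: "s \<in> states N \<Longrightarrow> i \<in> {1..N} \<Longrightarrow> flip i s \<in> states N"
  unfolding states_def flip_def by (auto simp: PiE_def extensional_def)

definition cooperative :: "nat \<Rightarrow> (state \<Rightarrow> state) \<Rightarrow> bool" where
  "cooperative N f \<longleftrightarrow>
     (\<forall>s \<in> states N. \<forall>s' \<in> states N.
        (\<forall>i \<in> {1..N}. s i \<le> s' i) \<longrightarrow> (\<forall>i \<in> {1..N}. f s i \<le> f s' i))"

text \<open>\<open>takes_input N f j i\<close>: the regulatory function of variable \<open>j\<close> depends on variable \<open>i\<close>.\<close>

definition takes_input :: "nat \<Rightarrow> (state \<Rightarrow> state) \<Rightarrow> nat \<Rightarrow> nat \<Rightarrow> bool" where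
  "takes_input N f j i \<longleftrightarrow> (\<exists>s \<in> states N. f (flip i s) j \<noteq> f s j)"

definition indegree :: "nat \<Rightarrow> (state \<Rightarrow> state) \<Rightarrow> nat \<Rightarrow> nat" where
  "indegree N f j = card {i \<in> {1..N}. takes_input N f j i}"

definition outdegree :: "nat \<Rightarrow> (state \<Rightarrow> state) \<Rightarrow> nat \<Rightarrow> nat" where
  "outdegree N f i = card {j \<in> {1..N}. takes_input N f j i}"

definition biquadratic :: "nat \<Rightarrow> (state \<Rightarrow> state) \<Rightarrow> bool" where
  "biquadratic N f \<longleftrightarrow> (\<forall>i \<in> {1..N}. indegree N f i \<le> 2 \<and> outdegree N f i \<le> 2)"

definition attractors :: "nat \<Rightarrow> (state \<Rightarrow> state) \<Rightarrow> state set set" where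
  "attractors N f =
     {range (\<lambda>t. (f ^^ t) s) | s. s \<in> states N \<and> (\<exists>k>0. (f ^^ k) s = s)}"

definition basin :: "nat \<Rightarrow> (state \<Rightarrow> state) \<Rightarrow> state set \<Rightarrow> state set" where
  "basin N f A = {s \<in> states N. \<exists>t. (f ^^ t) s \<in> A}"

definition chaotic :: "real \<Rightarrow> real \<Rightarrow> nat \<Rightarrow> (state \<Rightarrow> state) \<Rightarrow> bool" where
  "chaotic p c N f \<longleftrightarrow>
     measure_pmf.prob (pmf_of_set (states N))
       {s. \<exists>A \<in> attractors N f. s \<in> basin N f A \<and> real (card A) > c ^ N} > p"

text \<open>The initial state and the flipped coordinate are drawn independently.\<close>

definition unstable :: "real \<Rightarrow> nat \<Rightarrow> (state \<Rightarrow> state) \<Rightarrow> bool" where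
  "unstable p N f \<longleftrightarrow>
     measure_pmf.prob (pair_pmf (pmf_of_set (states N)) (pmf_of_set {1..N}))
       {(s, i). \<exists>A \<in> attractors N f. \<exists>B \<in> attractors N f.
                  A \<noteq> B \<and> s \<in> basin N f A \<and> flip i s \<in> basin N f B} \<ge> p"

end

theory Submission
  imports Defs "HOL-Real_Asymp.Real_Asymp"
begin

text \<open>
  The network consists of a machine of bounded size and a bounded number of wires.  At every time
  step the machine reads one bit from each wire, computes a monotone function of these bits and
  feeds the results back into the wires, whose lengths are of order \<open>N\<close>.  Almost all variables
  therefore only copy their predecessor, and any monotone function on a bounded number of bits may be
  used: it is an \<open>OR\<close> of \<open>AND\<close>s, which a pipelined circuit of copying, \<open>AND\<close> and \<open>OR\<close> gates evaluates
  with fan-in and fan-out two (\<open>Node_root\<close>, \<open>sig_loop\<close>).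

  \<^emph>\<open>Booting.\<close>  Monotone functions cannot negate, so control signals come in complementary pairs of wires.
  A line fed with the constant \<open>True\<close>, in which every cell is the \<open>AND\<close> of its two predecessors, is
  \<open>False\<close> at its end until time \<open>K\<close>, up to unlikely runs of ones, and \<open>True\<close> from then on; the
  dual line does the opposite.  Taking \<open>v\<close> lines of each kind makes the probability
  that the pair of signals is not \<^emph>\<open>exactly\<close> the step function at time \<open>K\<close> at most \<open>8 / 2 ^ v\<close>, uniformly in \<open>K\<close>
  (\<open>prob_not_clean\<close>, \<open>clean_booted\<close>).  So the machine knows whether the first \<open>K\<close> steps are over.

  \<^emph>\<open>Chaos.\<close>  The bulk of the network is a ring of \<open>K\<close> blocks of \<open>2 * M\<close> bits.  During the boot phase every
  block is overwritten by the code of the digit zero.  Afterwards the ring is an odometer whose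
  digits are coded by sets of size exactly \<open>M\<close>; these form an antichain, on which every function
  extends to a monotone one.  The base is one less than the central binomial coefficient, and the
  carry out of the last digit has period at least \<open>base ^ (K - const)\<close> (\<open>odometer\<close>, \<open>booted_period\<close>),
  which exceeds \<open>c ^ N\<close> if first \<open>M\<close> and then \<open>N\<close> is large.

  \<^emph>\<open>Instability.\<close>  Before a random block is overwritten, its weight is recorded in unary by \<open>2 * R + 1\<close>
  storage bits, which then circulate unchanged for ever.  Recording the weights in a window
  around \<open>M\<close> suffices, since by Chebyshev's inequality (\<open>card_unbalanced\<close>) the weight is rarely outside it, so
  \<open>R\<close> may be a small fraction of \<open>M\<close>.  Flipping one bit of a block changes the number of stored ones
  upwards or downwards, by monotonicity of the whole system, and this number is an invariant of the
  attractor (\<open>flip_changes_attractor\<close>).  As nearly all variables belong to blocks, nearly every flip changes the attractor.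
\<close>

section \<open>Networks of monotone gates\<close>

datatype 'v gate = Cst bool | And 'v 'v | Or 'v 'v

primrec gate_val :: "('v \<Rightarrow> bool) \<Rightarrow> 'v gate \<Rightarrow> bool" where
  "gate_val \<sigma> (Cst b) = b"
| "gate_val \<sigma> (And u w) = (\<sigma> u \<and> \<sigma> w)"
| "gate_val \<sigma> (Or u w) = (\<sigma> u \<or> \<sigma> w)"

primrec gate_inputs :: "'v gate \<Rightarrow> 'v set" where
  "gate_inputs (Cst b) = {}"
| "gate_inputs (And u w) = {u, w}"
| "gate_inputs (Or u w) = {u, w}"

abbreviation Copy :: "'v \<Rightarrow> 'v gate" where
  "Copy u \<equiv> And u u"

lemma gate_val_cong:
  "(\<And>u. u \<in> gate_inputs g \<Longrightarrow> \<sigma> u = \<sigma>' u) \<Longrightarrow> gate_val \<sigma> g = gate_val \<sigma>' g"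
  by (cases g) auto

lemma gate_val_mono:
  "(\<And>u. u \<in> gate_inputs g \<Longrightarrow> \<sigma> u \<le> \<sigma>' u) \<Longrightarrow> gate_val \<sigma> g \<le> gate_val \<sigma>' g"
  by (cases g) auto

lemma card_gate_inputs: "card (gate_inputs g) \<le> 2"
  by (cases g) (auto simp: card_insert_if)

lemma finite_gate_inputs: "finite (gate_inputs g)"
  by (cases g) auto

text \<open>
  Gates are wired up on an arbitrary set \<open>V\<close> of variables, which may carry the geometry of the
  construction; \<open>idx\<close> then numbers them.  Copies are written as \<open>AND\<close>s of a variable with itself, so fan-out counts
  the gates that read a variable.
\<close>

locale gate_network =
  fixes V :: "'v set" and gate :: "'v \<Rightarrow> 'v gate" and idx :: "'v \<Rightarrow> nat" and N :: nat
  assumes idx_bij: "bij_betw idx V {1..N}"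
    and inputs_in_V: "v \<in> V \<Longrightarrow> gate_inputs (gate v) \<subseteq> V"
    and fan_out: "u \<in> V \<Longrightarrow> card {v \<in> V. u \<in> gate_inputs (gate v)} \<le> 2"
begin

definition net :: "state \<Rightarrow> state" where
  "net s = (\<lambda>i\<in>{1..N}. gate_val (\<lambda>v. s (idx v)) (gate (inv_into V idx i)))"

lemma idx_in: "v \<in> V \<Longrightarrow> idx v \<in> {1..N}"
  using idx_bij by (auto simp: bij_betw_def)

lemma idx_surj: "i \<in> {1..N} \<Longrightarrow> \<exists>v\<in>V. i = idx v"
  using idx_bij by (auto simp: bij_betw_def)

lemma idx_eq_iff: "u \<in> V \<Longrightarrow> v \<in> V \<Longrightarrow> idx u = idx v \<longleftrightarrow> u = v"
  using idx_bij by (auto simp: bij_betw_def inj_on_def)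

lemma finite_V: "finite V"
  using idx_bij bij_betw_finite by blast

lemma net_idx: "v \<in> V \<Longrightarrow> net s (idx v) = gate_val (\<lambda>u. s (idx u)) (gate v)"
  using idx_in idx_bij unfolding net_def by (simp add: bij_betw_def inv_into_f_f)

lemma net_in_states: "net s \<in> states N"
  unfolding net_def states_def by auto

lemma boolean_network_net: "boolean_network N net"
  unfolding boolean_network_def using net_in_states by auto

lemma net_mono:
  assumes "\<forall>i\<in>{1..N}. s i \<le> s' i"
  shows "\<forall>i\<in>{1..N}. net s i \<le> net s' i"
proof
  fix i assume "i \<in> {1..N}"
  then obtain v where v: "v \<in> V" "i = idx v" using idx_surj by blast
  have "gate_val (\<lambda>u. s (idx u)) (gate v) \<le> gate_val (\<lambda>u. s' (idx u)) (gate v)"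
    by (rule gate_val_mono) (use assms v inputs_in_V idx_in in blast)
  with v show "net s i \<le> net s' i" by (simp add: net_idx)
qed

lemma cooperative_net: "cooperative N net"
  unfolding cooperative_def using net_mono by blast

lemma takes_input_net:
  assumes "v \<in> V" "u \<in> V" "takes_input N net (idx v) (idx u)"
  shows "u \<in> gate_inputs (gate v)"
proof (rule ccontr)
  assume u: "u \<notin> gate_inputs (gate v)"
  obtain s where "net (flip (idx u) s) (idx v) \<noteq> net s (idx v)"
    using assms(3) unfolding takes_input_def by blast
  moreover have "gate_val (\<lambda>w. flip (idx u) s (idx w)) (gate v) = gate_val (\<lambda>w. s (idx w)) (gate v)"
  proof (rule gate_val_cong)
    fix w assume "w \<in> gate_inputs (gate v)"
    then have "w \<in> V" "w \<noteq> u" using u inputs_in_V assms by auto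
    then show "flip (idx u) s (idx w) = s (idx w)"
      using assms by (simp add: flip_def idx_eq_iff)
  qed
  ultimately show False using assms by (simp add: net_idx)
qed

lemma biquadratic_net: "biquadratic N net"
  unfolding biquadratic_def
proof (intro ballI conjI)
  fix i assume "i \<in> {1..N}"
  then obtain v where v: "v \<in> V" "i = idx v" using idx_surj by blast
  have "{k \<in> {1..N}. takes_input N net i k} \<subseteq> idx ` gate_inputs (gate v)"
    using v takes_input_net idx_surj by fastforce
  then have "indegree N net i \<le> card (idx ` gate_inputs (gate v))"
    unfolding indegree_def by (intro card_mono) (auto simp: finite_gate_inputs)
  also have "\<dots> \<le> 2"
    using card_image_le[OF finite_gate_inputs] card_gate_inputs le_trans by blast
  finally show "indegree N net i \<le> 2" .
  have fin: "finite {w \<in> V. v \<in> gate_inputs (gate w)}" using finite_V by simp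
  have "{k \<in> {1..N}. takes_input N net k i} \<subseteq> idx ` {w \<in> V. v \<in> gate_inputs (gate w)}"
    using v takes_input_net idx_surj by fastforce
  then have "outdegree N net i \<le> card (idx ` {w \<in> V. v \<in> gate_inputs (gate w)})"
    unfolding outdegree_def by (intro card_mono finite_imageI fin)
  also have "\<dots> \<le> 2"
    using card_image_le[OF fin] fan_out[OF v(1)] le_trans by blast
  finally show "outdegree N net i \<le> 2" .
qed

definition cell :: "state \<Rightarrow> nat \<Rightarrow> 'v \<Rightarrow> bool" where
  "cell s t v = (net ^^ t) s (idx v)"

lemma cell_0: "cell s 0 v = s (idx v)"
  by (simp add: cell_def)

lemma cell_Suc: "v \<in> V \<Longrightarrow> cell s (Suc t) v = gate_val (cell s t) (gate v)"
  by (simp add: cell_def[abs_def] net_idx)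

lemma cell_mono:
  assumes "\<forall>i\<in>{1..N}. s i \<le> s' i" "v \<in> V"
  shows "cell s t v \<le> cell s' t v"
proof -
  have "\<forall>i\<in>{1..N}. (net ^^ t) s i \<le> (net ^^ t) s' i"
    by (induction t) (use assms net_mono in auto)
  then show ?thesis using assms idx_in by (simp add: cell_def)
qed

lemma cell_shift: "(net ^^ a) s = (net ^^ b) s' \<Longrightarrow> cell s (t + a) v = cell s' (t + b) v"
  by (simp add: cell_def funpow_add)

end

section \<open>A finite monotone machine with delay lines\<close>

datatype cell = Line nat nat | Fan nat nat nat | Node nat nat nat | Pad nat

datatype wire_kind = Loop | Fill bool

text \<open>
  On a wire of kind \<open>Fill b\<close> the constant \<open>b\<close> enters, and a cell takes the value \<open>b\<close> only if both of its
  predecessors have it: a conjunction for \<open>b = True\<close>, a disjunction for \<open>b = False\<close>.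
\<close>

definition junct :: "bool \<Rightarrow> 'v \<Rightarrow> 'v \<Rightarrow> 'v gate" where
  "junct b u w = (if b then And u w else Or u w)"

lemma gate_val_junct: "gate_val \<sigma> (junct b u w) = b \<longleftrightarrow> \<sigma> u = b \<and> \<sigma> w = b"
  by (auto simp: junct_def)

lemma gate_inputs_junct: "gate_inputs (junct b u w) = {u, w}"
  by (auto simp: junct_def)

text \<open>
  The leaves below node \<open>k\<close> of a binary tree are the leaves below its children \<open>2 * k\<close> and
  \<open>2 * k + 1\<close>.
\<close>

lemma ex_less_2_power_Suc:
  fixes P :: "nat \<Rightarrow> bool"
  shows "(\<exists>q<2 ^ Suc r. P (k * 2 ^ Suc r + q)) \<longleftrightarrow>
    (\<exists>q<2 ^ r. P (2 * k * 2 ^ r + q)) \<or> (\<exists>q<2 ^ r. P (Suc (2 * k) * 2 ^ r + q))"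
    (is "?L \<longleftrightarrow> ?R1 \<or> ?R2")
proof
  assume ?L
  then obtain q where q: "q < 2 ^ Suc r" "P (k * 2 ^ Suc r + q)" by blast
  show "?R1 \<or> ?R2"
  proof (cases "q < 2 ^ r")
    case True
    then show ?thesis using q by (auto simp: algebra_simps)
  next
    case False
    then have "q - 2 ^ r < 2 ^ r" "Suc (2 * k) * 2 ^ r + (q - 2 ^ r) = k * 2 ^ Suc r + q"
      using q by (auto simp: algebra_simps)
    then show ?thesis using q by metis
  qed
next
  assume "?R1 \<or> ?R2"
  then show ?L
  proof
    assume ?R1
    then obtain q where "q < 2 ^ r" "P (2 * k * 2 ^ r + q)" by blast
    then show ?L by (intro exI[of _ q]) (auto simp: algebra_simps)
  next
    assume ?R2
    then obtain q where "q < 2 ^ r" "P (Suc (2 * k) * 2 ^ r + q)" by blast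
    then show ?L by (intro exI[of _ "2 ^ r + q"]) (auto simp: algebra_simps)
  qed
qed

lemma all_less_2_power_Suc:
  fixes P :: "nat \<Rightarrow> bool"
  shows "(\<forall>q<2 ^ Suc r. P (k * 2 ^ Suc r + q)) \<longleftrightarrow>
    (\<forall>q<2 ^ r. P (2 * k * 2 ^ r + q)) \<and> (\<forall>q<2 ^ r. P (Suc (2 * k) * 2 ^ r + q))"
  using ex_less_2_power_Suc[of r "\<lambda>q. \<not> P q" k] by blast

lemma ex_bit_pattern: "\<exists>a<(2 :: nat) ^ n. \<forall>j<n. bit a j \<longleftrightarrow> y j"
proof (induction n)
  case 0
  show ?case by (rule exI[of _ 0]) simp
next
  case (Suc n)
  then obtain a :: nat where a: "a < 2 ^ n" "\<forall>j<n. bit a j \<longleftrightarrow> y j" by blast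
  let ?a = "if y n then set_bit n a else a"
  have na: "\<not> bit a n" using a(1) by (metis bit_take_bit_iff less_irrefl take_bit_nat_eq_self)
  have "take_bit (Suc n) (set_bit n a) = set_bit n a"
    by (rule bit_eqI) (use a(1) in \<open>auto simp: bit_simps, metis bit_take_bit_iff less_SucI take_bit_nat_eq_self\<close>)
  then have "?a < 2 ^ Suc n" using a(1) by (auto simp: take_bit_nat_eq_self_iff)
  moreover have "\<forall>j<Suc n. bit ?a j \<longleftrightarrow> y j"
    using a(2) na by (auto simp: bit_simps less_Suc_eq)
  ultimately show ?case by blast
qed

text \<open>
  Each of the \<open>n\<close> wires is a line of \<open>len i\<close> cells.  The output \<open>G i\<close> of the machine enters wire \<open>i\<close> if its kind
  is \<open>Loop\<close>.  The single assumption on \<open>G\<close> expresses both monotonicity and that \<open>G\<close> reads wires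
  below \<open>n\<close> only.
\<close>

locale delay_machine =
  fixes n :: nat and G :: "nat \<Rightarrow> (nat \<Rightarrow> bool) \<Rightarrow> bool"
    and len :: "nat \<Rightarrow> nat" and kind :: "nat \<Rightarrow> wire_kind" and pad :: nat
  assumes G_mono: "(\<And>j. j < n \<Longrightarrow> x j \<le> y j) \<Longrightarrow> G i x \<le> G i y"
    and len_pos: "i < n \<Longrightarrow> 0 < len i"
begin

definition cells :: "cell set" where
  "cells = {Line i p | i p. i < n \<and> p < len i}
     \<union> {Fan i l k | i l k. i < n \<and> l \<le> 3 * n \<and> k < 2 ^ l}
     \<union> {Node i l k | i l k. i < n \<and> l \<le> 2 * n \<and> k < 2 ^ l}
     \<union> {Pad k | k. k < pad}"

text \<open>
  The circuit evaluates \<open>G i y \<longleftrightarrow> (\<exists>a<2 ^ n. G i (bit a) \<and> (\<forall>j<n. bit a j \<longrightarrow> y j))\<close>, where the bits of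
  \<open>a\<close> encode a subset of the wires.  \<open>Node i l k\<close> is the \<open>k\<close>-th node at depth \<open>l\<close> of a complete binary
  tree: the upper \<open>n\<close> levels are the disjunction over \<open>a\<close>, the lower \<open>n\<close> levels a conjunction over
  \<open>j < 2 ^ n\<close>, padded with \<open>True\<close>.  There are \<open>n * 4 ^ n \<le> 2 ^ (3 * n)\<close> leaves in all, so a copying tree
  \<open>Fan j\<close> of depth \<open>3 * n\<close> has a separate leaf with the value of wire \<open>j\<close> for each of them, and no
  variable is read more than twice.
\<close>

fun wiring :: "cell \<Rightarrow> cell gate" where
  "wiring (Pad k) = Cst False"
| "wiring (Line i 0) = (case kind i of Loop \<Rightarrow> Copy (Node i 0 0) | Fill b \<Rightarrow> Cst b)"
| "wiring (Line i (Suc p)) =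
     (case kind i of Loop \<Rightarrow> Copy (Line i p) | Fill b \<Rightarrow> junct b (Line i p) (Line i (p - 1)))"
| "wiring (Fan i 0 k) = Copy (Line i (len i - 1))"
| "wiring (Fan i (Suc l) k) = Copy (Fan i l (k div 2))"
| "wiring (Node i l k) =
     (if l < n then Or (Node i (Suc l) (2 * k)) (Node i (Suc l) (Suc (2 * k)))
      else if l < 2 * n then And (Node i (Suc l) (2 * k)) (Node i (Suc l) (Suc (2 * k)))
      else let a = k div 2 ^ n; j = k mod 2 ^ n in
        if \<not> G i (bit a) then Cst False
        else if j < n \<and> bit a j then Copy (Fan j (3 * n) (i * 4 ^ n + k)) else Cst True)"

lemma cells_simps [simp]:
  "Line i p \<in> cells \<longleftrightarrow> i < n \<and> p < len i"
  "Fan i l k \<in> cells \<longleftrightarrow> i < n \<and> l \<le> 3 * n \<and> k < 2 ^ l"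
  "Node i l k \<in> cells \<longleftrightarrow> i < n \<and> l \<le> 2 * n \<and> k < 2 ^ l"
  "Pad k \<in> cells \<longleftrightarrow> k < pad"
  by (auto simp: cells_def)

lemma slot_bound: "i < n \<Longrightarrow> k < 4 ^ n \<Longrightarrow> i * 4 ^ n + k < 2 ^ (3 * n)"
proof -
  assume "i < n" "k < 4 ^ n"
  then have "i * 4 ^ n + k < Suc i * 4 ^ n" by simp
  also have "\<dots> \<le> 2 ^ n * 4 ^ n"
    using \<open>i < n\<close> less_exp[of n] by (intro mult_right_mono) linarith+
  also have "(2 ^ n * 4 ^ n :: nat) = 2 ^ (3 * n)"
    by (simp add: power_mult_distrib[symmetric] power_mult)
  finally show ?thesis .
qed

lemma four_power: "(4 :: nat) ^ n = 2 ^ (2 * n)"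
  by (simp add: power_mult)

lemma wiring_inputs: "v \<in> cells \<Longrightarrow> gate_inputs (wiring v) \<subseteq> cells"
proof (induction v rule: wiring.induct)
  case (6 i l k)
  show ?case
  proof (cases "l < 2 * n")
    case True
    have "2 * k < 2 ^ Suc l" "Suc (2 * k) < 2 ^ Suc l" using 6 by auto
    then show ?thesis using 6 True by auto
  next
    case False
    then have "k < 4 ^ n" using 6 by (auto simp: four_power)
    then show ?thesis using 6 False slot_bound[of i k] by (auto simp: Let_def)
  qed
qed (auto simp: gate_inputs_junct len_pos split: wire_kind.splits)

lemma gate_inputs_Node:
  "gate_inputs (wiring (Node i l k)) \<subseteq>
     (if l < 2 * n then {Node i (Suc l) (2 * k), Node i (Suc l) (Suc (2 * k))}
      else {Fan (k mod 2 ^ n) (3 * n) (i * 4 ^ n + k)})"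
  by (auto simp: Let_def)

lemma wiring_fan_out:
  assumes "u \<in> cells"
  shows "card {v \<in> cells. u \<in> gate_inputs (wiring v)} \<le> 2"
proof -
  have two: "card {v \<in> cells. u \<in> gate_inputs (wiring v)} \<le> 2"
    if "{v \<in> cells. u \<in> gate_inputs (wiring v)} \<subseteq> {a, b}" for a b
    using card_mono[OF _ that] card_insert_le_m1[of 2 "{b}" a] by (simp add: card_insert_if split: if_splits)
  have nodes: "Suc l' = l \<and> k' = k div 2" 
    if "Node i l k \<in> gate_inputs (wiring (Node i' l' k'))" for i l k i' l' k'
    using that gate_inputs_Node[of i' l' k'] by (auto split: if_splits)
  have lines: "v = Line i (Suc p) \<or> v = Line i (Suc (Suc p)) \<or> v = Fan i 0 0 \<and> p = len i - 1"
    if "Line i p \<in> gate_inputs (wiring v)" "v \<in> cells" for i p v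
    using that by (induction v rule: wiring.induct)
      (auto simp: gate_inputs_junct Let_def split: wire_kind.splits if_splits)
  have fans: "l < 3 * n \<and> (v = Fan i (Suc l) (2 * k) \<or> v = Fan i (Suc l) (Suc (2 * k)))
      \<or> l = 3 * n \<and> v = Node (k div 4 ^ n) (2 * n) (k mod 4 ^ n)"
    if "Fan i l k \<in> gate_inputs (wiring v)" "v \<in> cells" for i l k v
    using that
  proof (induction v rule: wiring.induct)
    case (6 i' l' k')
    then have "l' = 2 * n" "k' < 4 ^ n" "l = 3 * n" "k = i' * 4 ^ n + k'"
      by (auto simp: four_power Let_def split: if_splits)
    then show ?case by simp
  qed (auto simp: gate_inputs_junct split: wire_kind.splits)
  show ?thesis
  proof (cases u)
    case (Line i p)
    show ?thesis
    proof (cases "p = len i - 1")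
      case True
      have "{v \<in> cells. u \<in> gate_inputs (wiring v)} \<subseteq> {Fan i 0 0, Fan i 0 0}"
        using lines[of i p] Line True assms by fastforce
      then show ?thesis by (rule two)
    next
      case False
      have "{v \<in> cells. u \<in> gate_inputs (wiring v)} \<subseteq> {Line i (Suc p), Line i (Suc (Suc p))}"
        using lines[of i p] Line False by blast
      then show ?thesis by (rule two)
    qed
  next
    case (Fan i l k)
    show ?thesis
    proof (cases "l < 3 * n")
      case True
      have "{v \<in> cells. u \<in> gate_inputs (wiring v)} \<subseteq> {Fan i (Suc l) (2 * k), Fan i (Suc l) (Suc (2 * k))}"
        using fans[of i l k] Fan True by blast
      then show ?thesis by (rule two)
    next
      case False
      define w where "w = Node (k div 4 ^ n) (2 * n) (k mod 4 ^ n)"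
      have "{v \<in> cells. u \<in> gate_inputs (wiring v)} \<subseteq> {w, w}"
        using fans[of i l k] Fan False unfolding w_def by blast
      then show ?thesis by (rule two)
    qed
  next
    case (Node i l k)
    have "v = Node i (l - 1) (k div 2) \<or> v = Line i 0 \<and> l = 0"
      if "u \<in> gate_inputs (wiring v)" for v
      using that unfolding Node
    proof (induction v rule: wiring.induct)
      case (6 i' l' k')
      have "i' = i" using 6 gate_inputs_Node[of i' l' k'] by (auto split: if_splits)
      then show ?case using nodes[OF 6] by auto
    qed (auto simp: gate_inputs_junct split: wire_kind.splits)
    then have "{v \<in> cells. u \<in> gate_inputs (wiring v)} \<subseteq> {Node i (l - 1) (k div 2), Line i 0}" by blast
    then show ?thesis by (rule two)
  next
    case (Pad k)
    have "u \<notin> gate_inputs (wiring v)" for v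
      unfolding Pad by (induction v rule: wiring.induct)
        (auto simp: gate_inputs_junct Let_def split: wire_kind.splits)
    then show ?thesis by simp
  qed
qed

end

locale indexed_machine = delay_machine +
  fixes idx :: "cell \<Rightarrow> nat" and N :: nat
  assumes idx_cells: "bij_betw idx cells {1..N}"
begin

sublocale gate_network cells wiring idx N
  using idx_cells wiring_inputs wiring_fan_out by unfold_locales auto

definition lat :: nat where
  "lat = 5 * n + 2"

definition sig :: "state \<Rightarrow> nat \<Rightarrow> nat \<Rightarrow> bool" where
  "sig s t i = cell s t (Line i (len i - 1))"

lemma Fan_delay:
  "i < n \<Longrightarrow> l \<le> 3 * n \<Longrightarrow> k < 2 ^ l \<Longrightarrow> cell s (t + Suc l) (Fan i l k) = sig s t i"
proof (induction l arbitrary: k)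
  case 0
  then show ?case by (simp add: cell_Suc sig_def)
next
  case (Suc l)
  then show ?case by (simp add: cell_Suc)
qed

lemma Node_or_tree:
  "i < n \<Longrightarrow> l + r = n \<Longrightarrow> k < 2 ^ l \<Longrightarrow>
     cell s (t + r) (Node i l k) \<longleftrightarrow> (\<exists>q<2 ^ r. cell s t (Node i n (k * 2 ^ r + q)))"
proof (induction r arbitrary: l k)
  case 0
  then show ?case by simp
next
  case (Suc r)
  have "2 * k < 2 ^ Suc l" "Suc (2 * k) < 2 ^ Suc l" using Suc by auto
  with Suc show ?case
    unfolding ex_less_2_power_Suc[where P = "\<lambda>m. cell s t (Node i n m)"] by (simp add: cell_Suc del: power_Suc)
qed

lemma Node_and_tree:
  "i < n \<Longrightarrow> l + r = 2 * n \<Longrightarrow> r \<le> n \<Longrightarrow> k < 2 ^ l \<Longrightarrow>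
     cell s (t + r) (Node i l k) \<longleftrightarrow> (\<forall>q<2 ^ r. cell s t (Node i (2 * n) (k * 2 ^ r + q)))"
proof (induction r arbitrary: l k)
  case 0
  then show ?case by simp
next
  case (Suc r)
  have "2 * k < 2 ^ Suc l" "Suc (2 * k) < 2 ^ Suc l" using Suc by auto
  with Suc show ?case
    unfolding all_less_2_power_Suc[where P = "\<lambda>m. cell s t (Node i (2 * n) m)"] by (simp add: cell_Suc del: power_Suc)
qed

lemma Node_leaf:
  assumes "i < n" "a < 2 ^ n" "j < 2 ^ n"
  shows "cell s (t + 3 * n + 2) (Node i (2 * n) (a * 2 ^ n + j)) \<longleftrightarrow>
    G i (bit a) \<and> (j < n \<and> bit a j \<longrightarrow> sig s t j)"
proof -
  have "a * 2 ^ n + j < Suc a * 2 ^ n" using assms by simp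
  also have "\<dots> \<le> 2 ^ n * 2 ^ n" by (rule mult_right_mono) (use assms in auto)
  finally have k: "a * 2 ^ n + j < 4 ^ n" by (simp add: power_mult_distrib[symmetric])
  then have k': "a * 2 ^ n + j < 2 ^ (2 * n)" by (simp add: four_power)
  have dm: "(a * 2 ^ n + j) div 2 ^ n = a" "(a * 2 ^ n + j) mod 2 ^ n = j" using assms by auto
  have "cell s (Suc (t + Suc (3 * n))) (Node i (2 * n) (a * 2 ^ n + j)) =
      gate_val (cell s (t + Suc (3 * n))) (wiring (Node i (2 * n) (a * 2 ^ n + j)))"
    by (rule cell_Suc) (use assms k' in simp)
  also have "\<dots> \<longleftrightarrow> G i (bit a) \<and> (j < n \<and> bit a j \<longrightarrow> sig s t j)"
    using Fan_delay[of j "3 * n" "i * 4 ^ n + (a * 2 ^ n + j)" s t] slot_bound[OF assms(1) k]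
    unfolding wiring.simps dm Let_def by auto
  finally show ?thesis by simp
qed

text \<open>
  The trees compute the normal form given with \<open>wiring\<close>.  It represents \<open>G i\<close>: if the disjunct of \<open>a\<close> holds then
  \<open>bit a \<le> y\<close> on the wires, and conversely \<open>a\<close> can be chosen to agree with \<open>y\<close> there.
\<close>

lemma Node_root:
  assumes "i < n"
  shows "cell s (t + lat) (Node i 0 0) = G i (sig s t)"
proof -
  have split: "t + lat = ((t + 3 * n + 2) + n) + n" by (simp add: lat_def)
  let ?u = "t + 3 * n + 2"
  have "cell s ((?u + n) + n) (Node i 0 0) \<longleftrightarrow> (\<exists>a<(2::nat) ^ n. cell s (?u + n) (Node i n a))"
    using Node_or_tree[of i 0 n 0 s "?u + n"] assms by simp
  also have "\<dots> \<longleftrightarrow> (\<exists>a<(2::nat) ^ n. \<forall>j<2 ^ n. cell s ?u (Node i (2 * n) (a * 2 ^ n + j)))"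
    using Node_and_tree[of i n n _ s ?u] assms by (metis le_refl mult_2)
  also have "\<dots> \<longleftrightarrow> (\<exists>a<(2::nat) ^ n. \<forall>j<2 ^ n. G i (bit a) \<and> (j < n \<and> bit a j \<longrightarrow> sig s t j))"
    using Node_leaf[OF assms] by meson
  also have "\<dots> \<longleftrightarrow> G i (sig s t)"
  proof
    assume "\<exists>a<(2::nat) ^ n. \<forall>j<2 ^ n. G i (bit a) \<and> (j < n \<and> bit a j \<longrightarrow> sig s t j)"
    then obtain a :: nat where a: "\<forall>j<2 ^ n. G i (bit a) \<and> (j < n \<and> bit a j \<longrightarrow> sig s t j)" by blast
    have "G i (bit a) \<le> G i (sig s t)"
    proof (rule G_mono)
      fix j assume "j < n"
      moreover then have "j < 2 ^ n" using less_exp[of n] by linarith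
      ultimately show "bit a j \<le> sig s t j" using a by auto
    qed
    moreover have "G i (bit a)" using a by (metis zero_less_numeral zero_less_power)
    ultimately show "G i (sig s t)" by simp
  next
    assume g: "G i (sig s t)"
    obtain a :: nat where a: "a < 2 ^ n" "\<forall>j<n. bit a j \<longleftrightarrow> sig s t j"
      using ex_bit_pattern[of n "sig s t"] by blast
    have "G i (sig s t) \<le> G i (bit a)" by (rule G_mono) (use a in auto)
    with g a show "\<exists>a<(2::nat) ^ n. \<forall>j<2 ^ n. G i (bit a) \<and> (j < n \<and> bit a j \<longrightarrow> sig s t j)" by auto
  qed
  finally show ?thesis unfolding split .
qed

lemma Line_delay:
  "i < n \<Longrightarrow> kind i = Loop \<Longrightarrow> p < len i \<Longrightarrow> q \<le> p \<Longrightarrow> cell s (t + q) (Line i p) = cell s t (Line i (p - q))"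
proof (induction q arbitrary: p)
  case 0
  then show ?case by simp
next
  case (Suc q)
  then obtain p' where "p = Suc p'" by (cases p) auto
  with Suc show ?case by (simp add: cell_Suc)
qed

text \<open>
  With its latency \<open>lat\<close> added to the lengths of the wires, the machine acts as an instantaneous map; all later
  arguments about loops use this recurrence alone.
\<close>

theorem sig_loop:
  assumes "i < n" "kind i = Loop"
  shows "sig s (t + (len i + lat)) i = G i (sig s t)"
proof -
  have "0 < len i" using assms len_pos by blast
  then have "sig s (t + (len i + lat)) i = cell s (Suc (t + lat) + (len i - 1)) (Line i (len i - 1))"
    by (simp add: sig_def add_ac)
  also have "\<dots> = cell s (Suc (t + lat)) (Line i 0)"
    using assms \<open>0 < len i\<close> by (subst Line_delay) auto
  also have "\<dots> = G i (sig s t)"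
    using assms \<open>0 < len i\<close> by (simp add: cell_Suc Node_root)
  finally show ?thesis .
qed

lemma sig_initial:
  assumes "i < n" "kind i = Loop" "t < len i"
  shows "sig s t i = s (idx (Line i (len i - 1 - t)))"
  using Line_delay[of i "len i - 1" t s 0] assms by (simp add: sig_def cell_0)

text \<open>
  Cell \<open>p\<close> at time \<open>t\<close> collects the initial cells from \<open>p - 2 * t\<close> to \<open>p - t\<close>, because a signal
  advances by one or two cells per step.  The window is nonempty as long as \<open>t \<le> p\<close>, so a single
  \<open>\<not> b\<close> in it suppresses \<open>b\<close>, and it is empty afterwards.
\<close>

lemma Line_fill:
  assumes "i < n" "kind i = Fill b"
  shows "p < len i \<Longrightarrow> cell s t (Line i p) = b \<longleftrightarrow>
    (\<forall>k. p \<le> k + 2 * t \<longrightarrow> k + t \<le> p \<longrightarrow> s (idx (Line i k)) = b)"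
proof (induction t arbitrary: p)
  case 0
  have "(\<forall>k. p \<le> k + 2 * 0 \<longrightarrow> k + 0 \<le> p \<longrightarrow> s (idx (Line i k)) = b) \<longleftrightarrow> s (idx (Line i p)) = b"
    by (metis add.right_neutral le_antisym mult_0_right order_refl)
  then show ?case by (simp add: cell_0)
next
  case (Suc t)
  show ?case
  proof (cases p)
    case 0
    then show ?thesis using Suc.prems assms by (simp add: cell_Suc)
  next
    case (Suc p')
    have "cell s (Suc t) (Line i p) = b \<longleftrightarrow>
        cell s t (Line i p') = b \<and> cell s t (Line i (p' - 1)) = b"
      using Suc.prems Suc assms by (simp add: cell_Suc gate_val_junct)
    also have "\<dots> \<longleftrightarrow> (\<forall>k. p' \<le> k + 2 * t \<and> k + t \<le> p' \<or> p' - 1 \<le> k + 2 * t \<and> k + t \<le> p' - 1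
        \<longrightarrow> s (idx (Line i k)) = b)"
      using Suc.IH[of p'] Suc.IH[of "p' - 1"] Suc.prems Suc by auto
    also have "\<dots> \<longleftrightarrow> (\<forall>k. p \<le> k + 2 * Suc t \<and> k + Suc t \<le> p \<longrightarrow> s (idx (Line i k)) = b)"
    proof -
      have "(p' \<le> k + 2 * t \<and> k + t \<le> p' \<or> p' - 1 \<le> k + 2 * t \<and> k + t \<le> p' - 1) \<longleftrightarrow>
          (p \<le> k + 2 * Suc t \<and> k + Suc t \<le> p)" for k
        using Suc by auto
      then show ?thesis by simp
    qed
    finally show ?thesis by auto
  qed
qed

end

section \<open>An odometer\<close>

text \<open>
  \<open>q h k\<close> is the carry that arrives at digit \<open>h\<close> in round \<open>k\<close>.  A carry takes one round to move to the
  next digit, which only shifts the rounds.  If the carries at digit \<open>h\<close> come exactly every \<open>B ^ h\<close>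
  rounds, the digit overflows at every \<open>B\<close>-th of them.
\<close>

lemma odometer:
  fixes q :: "nat \<Rightarrow> nat \<Rightarrow> bool" and a :: "nat \<Rightarrow> nat \<Rightarrow> nat"
  assumes start: "\<And>k. n0 \<le> k \<Longrightarrow> q 0 k"
    and digit: "\<And>h k. h < m \<Longrightarrow> n0 \<le> k \<Longrightarrow> a h k < B"
    and count: "\<And>h k. h < m \<Longrightarrow> n0 \<le> k \<Longrightarrow> a h (Suc k) = (if q h k then Suc (a h k) mod B else a h k)"
    and carry: "\<And>h k. h < m \<Longrightarrow> n0 \<le> k \<Longrightarrow> q (Suc h) (Suc k) \<longleftrightarrow> q h k \<and> a h k = B - 1"
  shows "h \<le> m \<Longrightarrow> \<exists>k0\<ge>n0. \<forall>d. q h (k0 + d) \<longleftrightarrow> B ^ h dvd d"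
proof (induction h)
  case 0
  then show ?case using start by auto
next
  case (Suc h)
  then obtain k0 where k0: "n0 \<le> k0" and q: "\<And>d. q h (k0 + d) \<longleftrightarrow> B ^ h dvd d" by auto
  have h: "h < m" using Suc by simp
  have B: "0 < B" using digit[OF h, of n0] by simp
  define Q where "Q = B ^ h"
  have Q: "0 < Q" using B by (simp add: Q_def)
  have a: "a h (k0 + d) = (a h k0 + (d + (Q - 1)) div Q) mod B" for d
  proof (induction d)
    case 0
    then show ?case using digit[OF h k0] Q by simp
  next
    case (Suc d)
    have div: "(Suc d + (Q - 1)) div Q = (d + (Q - 1)) div Q + (if Q dvd d then 1 else 0)"
    proof -
      have "Suc d + (Q - 1) = d + Q" using Q by simp
      then have 1: "(Suc d + (Q - 1)) div Q = Suc (d div Q)" using Q by simp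
      show ?thesis
      proof (cases "Q dvd d")
        case True
        then obtain i where "d = Q * i" by blast
        have "(d + (Q - 1)) div Q = i"
          unfolding \<open>d = Q * i\<close> by (intro div_nat_eqI) (use Q in auto)
        moreover have "d div Q = i" using \<open>d = Q * i\<close> Q by simp
        ultimately show ?thesis using 1 True by simp
      next
        case False
        then have r: "0 < d mod Q" by (simp add: dvd_eq_mod_eq_0)
        have "d + (Q - 1) = Q * Suc (d div Q) + (d mod Q - 1)"
          using Q r mult_div_mod_eq[of Q d] by (simp del: mult_div_mod_eq)
        moreover have "d mod Q - 1 < Q" using Q by (meson less_imp_diff_less mod_less_divisor)
        ultimately have "(d + (Q - 1)) div Q = Suc (d div Q)" by (intro div_nat_eqI) auto
        then show ?thesis using 1 False by simp
      qed
    qed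
    have "a h (k0 + Suc d) = (if Q dvd d then Suc (a h (k0 + d)) mod B else a h (k0 + d))"
      using count[OF h, of "k0 + d"] k0 q[of d] by (simp add: Q_def)
    then show ?case unfolding div Suc by (simp add: mod_Suc_eq)
  qed
  \<comment> \<open>The digit overflows for the first time at the \<open>e\<close>-th carry after round \<open>k0\<close>.\<close>
  define e where "e = B - 1 - a h k0"
  have e: "a h k0 + e = B - 1" using digit[OF h k0] by (simp add: e_def)
  have full: "(B - 1 + i) mod B = B - 1 \<longleftrightarrow> B dvd i" for i
  proof (cases "B dvd i")
    case True
    then obtain k where "i = B * k" by blast
    then have "(B - 1 + i) mod B = (B - 1) mod B" by (metis mod_mult_self2)
    then show ?thesis using True B by simp
  next
    case False
    then obtain r where r: "i mod B = Suc r" by (metis dvd_eq_mod_eq_0 not0_implies_Suc)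
    have rB: "Suc r < B" using r B by (metis mod_less_divisor)
    have "(B - 1 + i) mod B = (B - 1 + Suc r) mod B" using r by (metis mod_add_right_eq)
    also have "\<dots> = (B + r) mod B" using B by simp
    also have "\<dots> = r" using rB by simp
    finally show ?thesis using False rB by simp
  qed
  have "q (Suc h) (Suc (k0 + Q * e) + d) \<longleftrightarrow> B ^ Suc h dvd d" for d
  proof -
    have "q (Suc h) (Suc (k0 + Q * e) + d) \<longleftrightarrow>
        q h (k0 + (Q * e + d)) \<and> a h (k0 + (Q * e + d)) = B - 1"
      using carry[OF h, of "k0 + (Q * e + d)"] k0 by (simp add: add_ac)
    also have "\<dots> \<longleftrightarrow> Q dvd d \<and> a h (k0 + (Q * e + d)) = B - 1"
      unfolding q Q_def[symmetric] by (simp add: dvd_add_right_iff)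
    also have "\<dots> \<longleftrightarrow> B ^ Suc h dvd d"
    proof (cases "Q dvd d")
      case True
      then obtain i where i: "d = Q * i" by blast
      have "Q * e + d + (Q - 1) = Q * (e + i) + (Q - 1)" using i by (simp add: algebra_simps)
      then have "(Q * e + d + (Q - 1)) div Q = e + i" using Q by (intro div_nat_eqI) auto
      then have "a h (k0 + (Q * e + d)) = (B - 1 + i) mod B"
        unfolding a using e by (metis add.assoc)
      then show ?thesis using True full[of i] Q i by (simp add: Q_def mult.commute)
    next
      case False
      then show ?thesis unfolding Q_def by (metis dvd_mult_right power_Suc)
    qed
    finally show ?thesis .
  qed
  then show ?case using k0 by (intro exI[of _ "Suc (k0 + Q * e)"]) simp
qed

section \<open>Attractors\<close>

lemma funpow_in_states:
  assumes "boolean_network N f" "s \<in> states N"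
  shows "(f ^^ t) s \<in> states N"
  using assms by (induction t) (auto simp: boolean_network_def)

lemma ex_attractor:
  assumes "boolean_network N f" "s \<in> states N"
  shows "\<exists>A\<in>attractors N f. s \<in> basin N f A"
proof -
  have "\<not> inj (\<lambda>t. (f ^^ t) s)"
  proof
    assume "inj (\<lambda>t. (f ^^ t) s)"
    then have "infinite (range (\<lambda>t. (f ^^ t) s))" by (rule range_inj_infinite)
    moreover have "range (\<lambda>t. (f ^^ t) s) \<subseteq> states N"
      using funpow_in_states[OF assms] by blast
    ultimately show False using finite_states finite_subset by blast
  qed
  then obtain a b where ab: "(f ^^ a) s = (f ^^ b) s" "a < b"
    unfolding inj_def by (metis linorder_neqE_nat)
  define r where "r = (f ^^ a) s"
  have "(f ^^ (b - a)) r = r"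
    unfolding r_def using ab by (metis comp_apply funpow_add le_add_diff_inverse2 less_imp_le)
  then have "range (\<lambda>t. (f ^^ t) r) \<in> attractors N f"
    unfolding attractors_def using ab(2) funpow_in_states[OF assms, of a]
    by (auto simp: r_def intro!: exI[of _ "b - a"] exI[of _ "(f ^^ a) s"])
  moreover have "s \<in> basin N f (range (\<lambda>t. (f ^^ t) r))"
    unfolding basin_def r_def using assms(2) by (auto intro!: exI[of _ a] range_eqI[of _ _ 0])
  ultimately show ?thesis by blast
qed

lemma attractor_tail:
  assumes "A \<in> attractors N f" "s \<in> basin N f A"
  shows "\<exists>r i t. (f ^^ t) s = (f ^^ i) r \<and> A = range (\<lambda>t. (f ^^ t) r)"
  using assms unfolding attractors_def basin_def by blast

text \<open>
  The attractor of \<open>s\<close> contains the trajectory of \<open>s\<close> from some time on, so a lower bound on the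
  distance of repetitions of the trajectory bounds its length.
\<close>

lemma card_attractor_ge:
  assumes "boolean_network N f" "A \<in> attractors N f" "s \<in> basin N f A"
    and distinct: "\<And>a b. a < b \<Longrightarrow> (f ^^ a) s = (f ^^ b) s \<Longrightarrow> m \<le> b - a"
  shows "m \<le> card A"
proof -
  obtain r i t where t: "(f ^^ t) s = (f ^^ i) r" and A: "A = range (\<lambda>t. (f ^^ t) r)"
    using attractor_tail[OF assms(2,3)] by blast
  have "inj_on (\<lambda>u. (f ^^ (u + t)) s) {..<m}"
  proof (rule inj_onI)
    have *: False if "x < y" "y < m" "(f ^^ (x + t)) s = (f ^^ (y + t)) s" for x y
      using distinct[of "x + t" "y + t"] that by simp
    fix x y assume "x \<in> {..<m}" "y \<in> {..<m}" "(f ^^ (x + t)) s = (f ^^ (y + t)) s"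
    then show "x = y" using *[of x y] *[of y x] by (metis lessThan_iff linorder_neqE_nat)
  qed
  moreover have "(f ^^ (u + t)) s \<in> A" for u
  proof -
    have "(f ^^ (u + t)) s = (f ^^ (u + i)) r" using t by (simp add: funpow_add)
    then show ?thesis unfolding A by blast
  qed
  moreover have "finite A"
  proof -
    have "A \<subseteq> states N"
      using assms(2) funpow_in_states[OF assms(1)] unfolding attractors_def by blast
    then show ?thesis using finite_states finite_subset by blast
  qed
  ultimately have "card {..<m} \<le> card A" by (intro card_inj_on_le) auto
  then show ?thesis by simp
qed

lemma same_attractor_meet:
  assumes "A \<in> attractors N f" "s \<in> basin N f A" "s' \<in> basin N f A"
  shows "\<exists>a b. (f ^^ (k + a)) s = (f ^^ (k + b)) s'"
proof -
  obtain r i t where t: "(f ^^ t) s = (f ^^ i) r" and A: "A = range (\<lambda>t. (f ^^ t) r)"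
    using attractor_tail[OF assms(1,2)] by blast
  obtain t' j where t': "(f ^^ t') s' = (f ^^ j) r"
    using assms(3) unfolding A basin_def by blast
  have "(f ^^ (j + t)) s = (f ^^ (i + t')) s'"
    using t t' by (metis add.commute comp_apply funpow_add)
  then have "(f ^^ (k + (j + t))) s = (f ^^ (k + (i + t'))) s'"
    by (simp add: funpow_add)
  then show ?thesis by blast
qed

section \<open>The counting machine\<close>

locale counter_params =
  fixes M R v K B :: nat and enc :: "nat \<Rightarrow> nat set" and pad :: nat
begin

definition L :: nat where "L = 2 * M"
definition W :: nat where "W = 2 * R + 1"

text \<open>
  The wires are, in this order: \<open>L\<close> data wires that carry one block at a time; \<open>W\<close> storage wires; a pair
  \<open>cw\<close> for the carry; a pair \<open>ew\<close> that tells whether the marker has been written; and \<open>v\<close> boot wires of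
  either kind.  In a pair, exactly the wire of the current truth value is \<open>True\<close>.
\<close>

definition width :: nat where "width = L + W + 4 + 2 * v"

definition cw :: "bool \<Rightarrow> nat" where "cw b = L + W + (if b then 0 else 1)"
definition ew :: "bool \<Rightarrow> nat" where "ew b = L + W + 2 + (if b then 0 else 1)"
definition bw :: "bool \<Rightarrow> nat \<Rightarrow> nat" where "bw b j = L + W + 4 + (if b then 0 else v) + j"

definition block :: "(nat \<Rightarrow> bool) \<Rightarrow> nat set" where
  "block y = {j. j < L \<and> y j}"

definition running :: "(nat \<Rightarrow> bool) \<Rightarrow> bool" where
  "running y \<longleftrightarrow> (\<forall>j<v. y (bw True j))"

definition booting :: "(nat \<Rightarrow> bool) \<Rightarrow> bool" where
  "booting y \<longleftrightarrow> (\<exists>j<v. y (bw False j))"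

text \<open>
  Digits are the symbols below \<open>B\<close>; the symbol \<open>B\<close> marks the low end of the odometer and emits a carry in every
  round.  While \<open>e\<close> is \<open>False\<close>, which is the case for a short time after booting, markers are
  written.  Several adjacent markers do no harm, as the digits form the rest of the ring.
\<close>

definition next_sym :: "nat \<Rightarrow> bool \<Rightarrow> bool \<Rightarrow> nat" where
  "next_sym x c e = (if \<not> e \<or> x = B then B else if c then Suc x mod B else x)"

definition next_carry :: "nat \<Rightarrow> bool \<Rightarrow> bool \<Rightarrow> bool" where
  "next_carry x c e \<longleftrightarrow> e \<and> (x = B \<or> c \<and> x = B - 1)"

text \<open>
  Requiring \<open>enc x \<subseteq> block y\<close> instead of equality makes the machine monotone.  On a block that is
  itself a code word the two agree, because code words have equal size.
\<close>

definition reads :: "(nat \<Rightarrow> bool) \<Rightarrow> nat \<Rightarrow> bool \<Rightarrow> bool \<Rightarrow> bool" where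
  "reads y x c e \<longleftrightarrow> x \<le> B \<and> enc x \<subseteq> block y \<and> y (cw c) \<and> y (ew e)"

text \<open>
  In the boot phase the storage wires receive the weight of the current block in unary, with the
  thresholds \<open>M - R, \<dots>, M + R\<close>.
\<close>

definition boot_out :: "nat \<Rightarrow> (nat \<Rightarrow> bool) \<Rightarrow> bool" where
  "boot_out i y \<longleftrightarrow>
     (if i < L then i \<in> enc 0
      else if i < L + W then M - R + (i - L) \<le> card (block y)
      else i = cw False \<or> i = ew False)"

definition run_out :: "nat \<Rightarrow> (nat \<Rightarrow> bool) \<Rightarrow> bool" where
  "run_out i y \<longleftrightarrow>
     (if i < L then \<exists>x c e. reads y x c e \<and> i \<in> enc (next_sym x c e)
      else if i < L + W then y i
      else i = ew True \<or> (\<exists>x c e. reads y x c e \<and> i = cw (next_carry x c e)))"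

definition update :: "nat \<Rightarrow> (nat \<Rightarrow> bool) \<Rightarrow> bool" where
  "update i y \<longleftrightarrow> booting y \<and> boot_out i y \<or> running y \<and> run_out i y"

text \<open>
  Together with the latency \<open>5 * width + 2\<close> of the machine, the loop delay is \<open>K\<close> for data and storage, so
  that the block read at time \<open>t\<close> is in slot \<open>t mod K\<close>.  It is \<open>K - 1\<close> for the carry, which
  thereby reaches the preceding slot in the next round.
\<close>

definition delay :: "nat \<Rightarrow> nat" where
  "delay i = (if i < L + W then K - (5 * width + 2)
     else if i < L + W + 2 then K - 1 - (5 * width + 2)
     else if i < L + W + 4 then 1 else K)"

definition role :: "nat \<Rightarrow> wire_kind" where
  "role i = (if i < L + W + 4 then Loop else if i < L + W + 4 + v then Fill True else Fill False)"

lemma wires_lt_width [simp]: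
  "i < L + W \<Longrightarrow> i < width" "cw b < width" "ew b < width" "j < v \<Longrightarrow> bw b j < width"
  by (auto simp: width_def cw_def ew_def bw_def)

lemma update_mono:
  assumes "\<And>j. j < width \<Longrightarrow> y j \<le> y' j"
  shows "update i y \<le> update i y'"
proof -
  have le: "y' j" if "j < width" "y j" for j using assms[OF that(1)] that(2) by simp
  have bl: "block y \<subseteq> block y'" unfolding block_def using le by auto
  then have crd: "card (block y) \<le> card (block y')"
    by (rule card_mono[rotated]) (simp add: block_def)
  have 1: "boot_out i y'" if "boot_out i y"
    using that order.trans[OF _ crd] unfolding boot_out_def by presburger
  have rd: "reads y x c e \<Longrightarrow> reads y' x c e" for x c e
    unfolding reads_def using bl le[of "cw c"] le[of "ew e"] by auto
  have 2: "run_out i y'" if "run_out i y"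
  proof (cases "i < L + W")
    case True
    then show ?thesis using that rd le[of i] wires_lt_width(1)[OF True] unfolding run_out_def
      by (cases "i < L") (simp_all del: wires_lt_width, blast+)
  next
    case False
    then have "\<not> i < L" by simp
    with False show ?thesis using that rd unfolding run_out_def if_not_P[OF False] if_not_P[OF \<open>\<not> i < L\<close>] by blast
  qed
  have 3: "booting y \<Longrightarrow> booting y'" unfolding booting_def using le by auto
  have 4: "running y \<Longrightarrow> running y'" unfolding running_def using le by auto
  show ?thesis unfolding update_def le_bool_def using 1 2 3 4 by blast
qed

end

locale counter_layout = counter_params +
  assumes K_large: "5 * width + 4 < K"
begin

sublocale delay_machine width update delay role pad
  using update_mono K_large by unfold_locales (auto simp: delay_def)

end

locale counter_machine = counter_layout +
  fixes idx :: "cell \<Rightarrow> nat" and N :: nat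
  assumes enc_bij: "bij_betw enc {..B} {S. S \<subseteq> {..<L} \<and> card S = M}"
    and B_pos: "0 < B"
    and idx_cells': "bij_betw idx cells {1..N}"
begin

sublocale indexed_machine width update delay role pad idx N
  using idx_cells' by unfold_locales

lemma lat_eq: "lat = 5 * width + 2"
  by (simp add: lat_def)

text \<open>
  From here on the boot signals are exact; that this is likely is a matter of probability only.
\<close>

definition booted :: "state \<Rightarrow> bool" where
  "booted s \<longleftrightarrow> (\<forall>t. (running (sig s t) \<longleftrightarrow> K \<le> t) \<and> (booting (sig s t) \<longleftrightarrow> t < K))"

lemma enc_in: "x \<le> B \<Longrightarrow> enc x \<subseteq> {..<L} \<and> card (enc x) = M"
  using enc_bij by (auto simp: bij_betw_def)

lemma enc_subset_iff: "x \<le> B \<Longrightarrow> x' \<le> B \<Longrightarrow> enc x \<subseteq> enc x' \<longleftrightarrow> x = x'"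
proof
  assume x: "x \<le> B" "x' \<le> B" "enc x \<subseteq> enc x'"
  have "finite (enc x')" using enc_in[OF x(2)] finite_subset by blast
  then have "enc x = enc x'" using card_subset_eq x enc_in by metis
  then show "x = x'" using enc_bij x by (auto simp: bij_betw_def inj_on_def)
qed simp

lemma next_sym_le: "x \<le> B \<Longrightarrow> next_sym x c e \<le> B"
  using B_pos by (auto simp: next_sym_def less_imp_le)

lemma block_eqI:
  assumes "S \<subseteq> {..<L}" "\<And>i. i < L \<Longrightarrow> y i \<longleftrightarrow> i \<in> S"
  shows "block y = S"
  using assms unfolding block_def by blast

lemma sig_boot:
  assumes "booted s" "t < K" "i < L + W + 4"
  shows "sig s (t + (delay i + lat)) i = boot_out i (sig s t)"
  using assms sig_loop[of i s t] by (simp add: role_def width_def update_def booted_def)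

lemma sig_run:
  assumes "booted s" "K \<le> t" "i < L + W + 4"
  shows "sig s (t + (delay i + lat)) i = run_out i (sig s t)"
  using assms sig_loop[of i s t] by (simp add: role_def width_def update_def booted_def)

lemma delay_lat:
  "i < L + W \<Longrightarrow> delay i + lat = K" "delay (cw b) + lat = K - 1" "delay (ew b) + lat = Suc lat"
  using K_large by (auto simp: delay_def lat_eq cw_def ew_def)

lemma wires_lt_loop [simp]: "i < L + W \<Longrightarrow> i < L + W + 4" "cw b < L + W + 4" "ew b < L + W + 4"
  by (auto simp: cw_def ew_def)

lemma wire_tests [simp]:
  "\<not> cw b < L" "\<not> cw b < L + W" "\<not> ew b < L" "\<not> ew b < L + W"
  "cw b = cw b' \<longleftrightarrow> b = b'" "ew b = ew b' \<longleftrightarrow> b = b'" "cw b \<noteq> ew b'" "ew b' \<noteq> cw b"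
  by (auto simp: cw_def ew_def)

section \<open>The storage bits and instability\<close>

lemma storage_boot:
  assumes "booted s" "t < K" "j < W"
  shows "sig s (t + K) (L + j) \<longleftrightarrow> M - R + j \<le> card (block (sig s t))"
  using sig_boot[OF assms(1,2), of "L + j"] delay_lat(1)[of "L + j"] assms(3)
  by (simp add: boot_out_def del: One_nat_def)

lemma storage_run:
  assumes "booted s" "K \<le> t" "j < W"
  shows "sig s (t + K) (L + j) \<longleftrightarrow> sig s t (L + j)"
  using sig_run[OF assms(1,2), of "L + j"] delay_lat(1)[of "L + j"] assms(3)
  by (simp add: run_out_def del: One_nat_def)

definition stored :: "state \<Rightarrow> nat \<Rightarrow> nat" where
  "stored s t = (\<Sum>j<W. of_bool (sig s t (L + j)))"

text \<open>
  The storage contents have period \<open>K\<close> after booting, so their sum over \<open>K\<close> consecutive steps does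
  not depend on where the window starts.
\<close>

lemma stored_window:
  assumes "booted s" "K \<le> t"
  shows "(\<Sum>u<K. stored s (u + t)) = (\<Sum>u<K. stored s (u + K))"
  using assms(2)
proof (induction t rule: dec_induct)
  case base
  then show ?case by simp
next
  case (step t)
  have "(\<Sum>u<K. stored s (u + Suc t)) + stored s t = (\<Sum>u<Suc K. stored s (u + t))"
    by (subst sum.lessThan_Suc_shift) simp
  also have "\<dots> = (\<Sum>u<K. stored s (u + t)) + stored s (t + K)" by (simp add: add.commute)
  also have "stored s (t + K) = stored s t"
    unfolding stored_def using storage_run[OF assms(1) step(1)] by (intro sum.cong) auto
  finally show ?case using step by simp
qed

lemma stored_invariant:
  assumes "booted s" "booted s'" "(net ^^ (K + a)) s = (net ^^ (K + b)) s'"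
  shows "(\<Sum>u<K. stored s (u + K)) = (\<Sum>u<K. stored s' (u + K))"
proof -
  have "sig s (u + (K + a)) = sig s' (u + (K + b))" for u
    unfolding sig_def using cell_shift[OF assms(3)] by auto
  then have "(\<Sum>u<K. stored s (u + (K + a))) = (\<Sum>u<K. stored s' (u + (K + b)))"
    unfolding stored_def by simp
  then show ?thesis using stored_window[OF assms(1), of "K + a"] stored_window[OF assms(2), of "K + b"]
    by simp
qed

definition column :: "state \<Rightarrow> nat \<Rightarrow> nat set" where
  "column s p = {j. j < L \<and> s (idx (Line j p))}"

lemma block_initial:
  assumes "t < K - lat"
  shows "block (sig s t) = column s (K - lat - 1 - t)"
  unfolding block_def column_def using assms
  by (auto simp: sig_initial role_def delay_def lat_eq)

text \<open>
  The larger initial state remains larger for ever, so no stored bit gets lost when the weight of a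
  column grows by one, and the threshold just reached gains one.
\<close>

lemma stored_less:
  assumes "booted s" "booted s'" and le: "\<forall>i\<in>{1..N}. s i \<le> s' i"
    and p: "p < K - lat" and col: "card (column s' p) = Suc (card (column s p))"
    and lo: "M - R \<le> card (column s p)" and hi: "card (column s p) < M - R + 2 * R"
  shows "(\<Sum>u<K. stored s (u + K)) < (\<Sum>u<K. stored s' (u + K))"
proof -
  define t where "t = K - lat - 1 - p"
  have t: "t < K - lat" "K - lat - 1 - t = p" using p by (auto simp: t_def)
  have le': "of_bool (sig s u (L + j)) \<le> (of_bool (sig s' u (L + j)) :: nat)" if "j < W" for u j
  proof -
    have "0 < delay (L + j)" "L + j < width" using that len_pos[of "L + j"] by (auto simp: width_def)
    then have "sig s u (L + j) \<le> sig s' u (L + j)"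
      unfolding sig_def by (intro cell_mono[OF le]) auto
    then show ?thesis by auto
  qed
  define j where "j = Suc (card (column s p)) - (M - R)"
  have j: "j < W" "M - R + j = Suc (card (column s p))" using lo hi by (auto simp: j_def W_def)
  have "stored s (t + K) < stored s' (t + K)"
    unfolding stored_def
  proof (rule sum_strict_mono_ex1)
    show "\<exists>j\<in>{..<W}. of_bool (sig s (t + K) (L + j)) < (of_bool (sig s' (t + K) (L + j)) :: nat)"
      using j t storage_boot[OF assms(1), of t j] storage_boot[OF assms(2), of t j] col
      by (intro bexI[of _ j]) (auto simp: block_initial)
  qed (use le' in auto)
  moreover have "stored s (u + K) \<le> stored s' (u + K)" for u
    unfolding stored_def using le' by (intro sum_mono) auto
  ultimately show ?thesis
    using t by (intro sum_strict_mono_ex1) auto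
qed

text \<open>
  If the two trajectories met, possibly with a time shift, the invariant number of stored ones would be
  the same.
\<close>

theorem flip_changes_attractor:
  assumes s: "s \<in> states N" and j: "j < L" and p: "p < K - lat"
    and b: "booted s" "booted (flip (idx (Line j p)) s)"
    and col: "M < card (column s p) + R" "card (column s p) < M + R"
  shows "\<exists>A\<in>attractors N net. \<exists>B\<in>attractors N net.
    A \<noteq> B \<and> s \<in> basin N net A \<and> flip (idx (Line j p)) s \<in> basin N net B"
proof -
  define i where "i = idx (Line j p)"
  have line: "Line j' p \<in> cells" if "j' < L" for j'
    using that p by (simp add: delay_def lat_eq)
  have i: "i \<in> {1..N}" unfolding i_def by (rule idx_in) (rule line[OF j])
  have col_flip: "column (flip i s) p = (if s i then column s p - {j} else insert j (column s p))"
    using j line idx_eq_iff unfolding column_def flip_def i_def by auto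
  have fin: "finite (column s p)" by (simp add: column_def)
  have neq: "(\<Sum>u<K. stored s (u + K)) \<noteq> (\<Sum>u<K. stored (flip i s) (u + K))"
  proof (cases "s i")
    case True
    then have "j \<in> column s p" using j by (simp add: column_def i_def)
    then have c: "card (column s p) = Suc (card (column (flip i s) p))"
      using col_flip True card.remove[OF fin] by simp
    have "(\<Sum>u<K. stored (flip i s) (u + K)) < (\<Sum>u<K. stored s (u + K))"
      by (rule stored_less[where p = p]) (use b p c col True in \<open>auto simp: i_def[symmetric] flip_def\<close>)
    then show ?thesis by simp
  next
    case False
    then have "j \<notin> column s p" using j by (simp add: column_def i_def)
    then have c: "card (column (flip i s) p) = Suc (card (column s p))"
      using col_flip False fin by simp
    have "(\<Sum>u<K. stored s (u + K)) < (\<Sum>u<K. stored (flip i s) (u + K))"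
      by (rule stored_less[where p = p]) (use b p c col False in \<open>auto simp: i_def[symmetric] flip_def\<close>)
    then show ?thesis by simp
  qed
  obtain A where A: "A \<in> attractors N net" "s \<in> basin N net A"
    using ex_attractor[OF boolean_network_net s] by blast
  obtain B where B: "B \<in> attractors N net" "flip i s \<in> basin N net B"
    using ex_attractor[OF boolean_network_net flip_in_states[OF s i]] by blast
  have "A \<noteq> B"
    using same_attractor_meet[OF A, of "flip i s" K] B neq stored_invariant[OF b] by (auto simp: i_def)
  with A B show ?thesis unfolding i_def by blast
qed

section \<open>The counter and its period\<close>

definition marked :: "nat \<Rightarrow> bool" where
  "marked t \<longleftrightarrow> K + Suc lat \<le> t"

lemma sig_ew:
  assumes "booted s" "K \<le> t"
  shows "sig s t (ew b) \<longleftrightarrow> b = marked t"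
proof -
  have 1: "Suc lat \<le> t" using assms K_large by (simp add: lat_eq)
  define u where "u = t - Suc lat"
  have t: "t = u + (delay (ew b) + lat)" using 1 by (simp add: u_def delay_lat)
  show ?thesis
  proof (cases "u < K")
    case True
    then have "\<not> marked t" using 1 by (simp add: marked_def u_def)
    then show ?thesis
      using sig_boot[OF assms(1) True wires_lt_loop(3)[of b], folded t] by (simp add: boot_out_def)
  next
    case False
    then have "K \<le> u" "marked t" using 1 by (simp_all add: marked_def u_def)
    then show ?thesis
      using sig_run[OF assms(1) \<open>K \<le> u\<close> wires_lt_loop(3)[of b], folded t] by (simp add: run_out_def)
  qed
qed

definition holds :: "state \<Rightarrow> nat \<Rightarrow> nat \<Rightarrow> bool" where
  "holds s t x \<longleftrightarrow> x \<le> B \<and> block (sig s t) = enc x"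

definition carries :: "state \<Rightarrow> nat \<Rightarrow> bool \<Rightarrow> bool" where
  "carries s t c \<longleftrightarrow> (\<forall>b. sig s t (cw b) \<longleftrightarrow> b = c)"

lemma holds_unique: "holds s t x \<Longrightarrow> holds s t x' \<Longrightarrow> x = x'"
  unfolding holds_def using enc_subset_iff by blast

lemma holds_boot:
  assumes "booted s" "t < K"
  shows "holds s (t + K) 0"
  unfolding holds_def
proof
  show "block (sig s (t + K)) = enc 0"
  proof (rule block_eqI)
    show "sig s (t + K) i \<longleftrightarrow> i \<in> enc 0" if "i < L" for i
      using sig_boot[OF assms, of i] delay_lat(1)[of i] that by (simp add: boot_out_def del: One_nat_def)
  qed (use enc_in[of 0] in simp)
qed simp

lemma carries_boot:
  assumes "booted s" "t < K"
  shows "carries s (t + (K - 1)) False"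
  unfolding carries_def
  using sig_boot[OF assms wires_lt_loop(2)] by (simp add: delay_lat boot_out_def)

lemma reads_iff:
  assumes "booted s" "K \<le> t" "holds s t x" "carries s t c"
  shows "reads (sig s t) x' c' e' \<longleftrightarrow> x' = x \<and> c' = c \<and> e' = marked t"
  using assms sig_ew[OF assms(1,2)] enc_subset_iff[of x' x]
  unfolding reads_def holds_def carries_def by auto

lemma holds_step:
  assumes "booted s" "K \<le> t" "holds s t x" "carries s t c"
  shows "holds s (t + K) (next_sym x c (marked t))"
proof -
  have x: "next_sym x c (marked t) \<le> B" using assms(3) next_sym_le unfolding holds_def by blast
  have "block (sig s (t + K)) = enc (next_sym x c (marked t))"
  proof (rule block_eqI)
    show "sig s (t + K) i \<longleftrightarrow> i \<in> enc (next_sym x c (marked t))" if "i < L" for i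
      using sig_run[OF assms(1,2), of i] delay_lat(1)[of i] that
      by (simp add: run_out_def reads_iff[OF assms] del: One_nat_def)
  qed (use enc_in[OF x] in simp)
  with x show ?thesis by (simp add: holds_def)
qed

lemma carries_step:
  assumes "booted s" "K \<le> t" "holds s t x" "carries s t c"
  shows "carries s (t + (K - 1)) (next_carry x c (marked t))"
  unfolding carries_def
  using sig_run[OF assms(1,2) wires_lt_loop(2)]
  by (simp add: delay_lat run_out_def reads_iff[OF assms])

text \<open>
  After booting, the blocks are code words and the carry pair is complementary: this holds for
  everything written in the boot phase and is preserved by each step.
\<close>

lemma legal:
  assumes "booted s" "K \<le> t"
  shows "(\<exists>x. holds s t x) \<and> (\<exists>c. carries s t c)"
  using assms(2)
proof (induction t rule: less_induct)
  case (less t)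
  have K: "2 \<le> K" using K_large by simp
  have "\<exists>x. holds s t x"
  proof (cases "t - K < K")
    case True
    then show ?thesis using holds_boot[OF assms(1) True] less by auto
  next
    case False
    then have "t - K < t" "K \<le> t - K" "t = (t - K) + K" using K by auto
    then show ?thesis using less.IH[of "t - K"] holds_step[OF assms(1), of "t - K"] by metis
  qed
  moreover have "\<exists>c. carries s t c"
  proof (cases "t - (K - 1) < K")
    case True
    then show ?thesis using carries_boot[OF assms(1) True] less K by auto
  next
    case False
    then have "t - (K - 1) < t" "K \<le> t - (K - 1)" "t = (t - (K - 1)) + (K - 1)" using K by auto
    then show ?thesis using less.IH[of "t - (K - 1)"] carries_step[OF assms(1), of "t - (K - 1)"] by metis
  qed
  ultimately show ?case by blast
qed

definition sym :: "state \<Rightarrow> nat \<Rightarrow> nat" where "sym s t = (SOME x. holds s t x)"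

definition carry :: "state \<Rightarrow> nat \<Rightarrow> bool" where "carry s t \<longleftrightarrow> sig s t (cw True)"

lemma holds_sym: "booted s \<Longrightarrow> K \<le> t \<Longrightarrow> holds s t (sym s t)"
  unfolding sym_def using legal someI_ex by metis

lemma carries_carry:
  assumes "booted s" "K \<le> t"
  shows "carries s t (carry s t)"
proof -
  obtain c where c: "carries s t c" using legal[OF assms] by blast
  then have "carry s t = c" by (simp add: carries_def carry_def)
  with c show ?thesis by simp
qed

lemma sym_step:
  "booted s \<Longrightarrow> K \<le> t \<Longrightarrow> sym s (t + K) = next_sym (sym s t) (carry s t) (marked t)"
  using holds_unique[OF holds_sym holds_step[OF _ _ holds_sym carries_carry]] by simp

lemma carry_step:
  "booted s \<Longrightarrow> K \<le> t \<Longrightarrow> carry s (t + (K - 1)) = next_carry (sym s t) (carry s t) (marked t)"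
  using carries_step[OF _ _ holds_sym carries_carry] unfolding carries_def carry_def by simp

lemma sym_marker:
  assumes "booted s" "u \<le> lat" "2 \<le> k"
  shows "sym s (u + k * K) = B"
  using assms(3)
proof (induction k rule: dec_induct)
  case base
  have "\<not> marked (u + K)" using assms by (simp add: marked_def)
  then show ?case using sym_step[OF assms(1), of "u + K"] by (simp add: next_sym_def mult_2 add.assoc)
next
  case (step k)
  have "K \<le> u + k * K" using step by (simp add: trans_le_add2)
  then show ?case using sym_step[OF assms(1), of "u + k * K"] step by (simp add: next_sym_def add_ac)
qed

lemma sym_digit:
  assumes "booted s" "lat < u" "u < K" "1 \<le> k"
  shows "sym s (u + k * K) < B"
  using assms(4)
proof (induction k rule: dec_induct)
  case base
  have "sym s (u + K) = 0"
    using holds_unique[OF holds_sym[OF assms(1)] holds_boot[OF assms(1,3)]] by simp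
  then show ?case using B_pos by simp
next
  case (step k)
  have "1 * K \<le> k * K" using step(1) by (rule mult_le_mono1)
  then have "marked (u + k * K)" unfolding marked_def mult_1 using assms(2) by linarith
  moreover have "K \<le> u + k * K" using step by (simp add: trans_le_add2)
  ultimately show ?case using sym_step[OF assms(1), of "u + k * K"] step B_pos
    by (simp add: next_sym_def add_ac)
qed

text \<open>
  Slots \<open>0, \<dots>, lat\<close> hold markers and the other slots are digits, numbered downwards from slot \<open>K - 1\<close>, whose
  carry comes from slot \<open>0\<close>.  A repetition of the state after \<open>b - a\<close> steps is also one after
  \<open>K * (b - a)\<close> steps, that is after \<open>b - a\<close> whole rounds, so the carries of the last digit must
  recur after \<open>b - a\<close> rounds.
\<close>

theorem booted_period:
  assumes s: "booted s" and ab: "a < b" "(net ^^ a) s = (net ^^ b) s"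
  shows "B ^ (K - lat - 2) dvd b - a"
proof -
  define m where "m = K - lat - 2"
  have K: "lat + 2 < K" using K_large by (simp add: lat_eq)
  define D where "D h k = sym s ((K - 1 - h) + k * K)" for h k
  define q where "q h k = carry s ((K - 1 - h) + k * K)" for h k
  have slot: "lat < K - 1 - h" "K - 1 - h < K" if "h < m" for h using that K by (auto simp: m_def)
  have late: "K \<le> u + k * K" "2 * K \<le> u + k * K" if "2 \<le> k" for u k :: nat
  proof -
    have "2 * K \<le> k * K" using that by (rule mult_le_mono1)
    then show "K \<le> u + k * K" "2 * K \<le> u + k * K" by linarith+
  qed
  have mk: "marked (u + k * K)" if "2 \<le> k" for u k
    using late(2)[OF that, of u] K by (simp add: marked_def)
  have start: "q 0 k" if "2 \<le> k" for k
    using carry_step[OF s late(1)[OF that, of 0]] sym_marker[OF s, of 0 k] mk[OF that, of 0] that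
    by (simp add: q_def next_carry_def add.commute)
  have digit: "D h k < B" if "h < m" "2 \<le> k" for h k
    unfolding D_def using sym_digit[OF s slot[OF that(1)]] that(2) by simp
  have count: "D h (Suc k) = (if q h k then Suc (D h k) mod B else D h k)" if "h < m" "2 \<le> k" for h k
    using sym_step[OF s late(1)[OF that(2)], of "K - 1 - h"] mk[OF that(2), of "K - 1 - h"] digit[OF that]
    by (simp add: D_def q_def next_sym_def add_ac)
  have cr: "q (Suc h) (Suc k) \<longleftrightarrow> q h k \<and> D h k = B - 1" if "h < m" "2 \<le> k" for h k
  proof -
    have e: "(K - 1 - Suc h) + Suc k * K = (K - 1 - h) + k * K + (K - 1)"
      using that slot[OF that(1)] by simp
    show ?thesis
      using carry_step[OF s late(1)[OF that(2)], of "K - 1 - h"] mk[OF that(2), of "K - 1 - h"] digit[OF that]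
      unfolding q_def D_def e by (simp add: next_carry_def del: One_nat_def)
  qed
  obtain k0 where k0: "\<And>d. q m (k0 + d) \<longleftrightarrow> B ^ m dvd d"
    using odometer[of 2 q m D B m, OF start digit count cr] by auto
  have per: "sig s (t + (b - a)) = sig s t" if "a \<le> t" for t
  proof -
    have "t + (b - a) = (t - a) + b" using that ab by simp
    then have "sig s (t + (b - a)) = sig s ((t - a) + b)" by (rule arg_cong)
    also have "\<dots> = sig s ((t - a) + a)"
      unfolding sig_def by (intro ext cell_shift[OF ab(2), symmetric])
    also have "(t - a) + a = t" by (rule le_add_diff_inverse2[OF that])
    finally show ?thesis .
  qed
  have per': "sig s (t + i * (b - a)) = sig s t" if "a \<le> t" for t i
  proof (induction i)
    case (Suc i)
    have "sig s (t + i * (b - a) + (b - a)) = sig s (t + i * (b - a))" by (rule per) (use that in simp)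
    then show ?case using Suc by (simp add: add_ac)
  qed simp
  have "q m (k0 + B ^ m * a + (b - a)) = q m (k0 + B ^ m * a)"
  proof -
    let ?t = "(K - 1 - m) + (k0 + B ^ m * a) * K"
    have "a * 1 \<le> (k0 + B ^ m * a) * K" using B_pos K by (intro mult_le_mono) (auto simp: trans_le_add2)
    then have "a \<le> ?t" by simp
    moreover have e: "(K - 1 - m) + (k0 + B ^ m * a + (b - a)) * K = ?t + K * (b - a)"
      by (simp add: algebra_simps)
    ultimately show ?thesis unfolding q_def carry_def e using per'[of ?t K] by simp
  qed
  then have "B ^ m dvd B ^ m * a + (b - a)" using k0[of "B ^ m * a + (b - a)"] k0[of "B ^ m * a"] by (simp add: add.assoc)
  then show ?thesis unfolding m_def[symmetric] by (simp add: dvd_add_right_iff)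
qed

end

section \<open>Random initial states\<close>

abbreviation prob_states :: "nat \<Rightarrow> state set \<Rightarrow> real" where
  "prob_states N \<equiv> measure_pmf.prob (pmf_of_set (states N))"

lemma states_nonempty: "states N \<noteq> {}"
  using card_states[of N] by (metis card.empty power_eq_0_iff zero_neq_numeral)

lemma prob_states_eq: "prob_states N X = real (card (states N \<inter> X)) / 2 ^ N"
  by (simp add: measure_pmf_of_set states_nonempty finite_states card_states)

lemma prob_prescribed:
  assumes "A \<subseteq> {1..N}"
  shows "prob_states N {s. \<forall>a\<in>A. s a = z a} = 1 / 2 ^ card A"
proof -
  have fin: "finite A" using assms finite_subset by blast
  have "states N \<inter> {s. \<forall>a\<in>A. s a = z a} = PiE {1..N} (\<lambda>i. if i \<in> A then {z i} else UNIV)"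
    using assms unfolding states_def PiE_def Pi_def by (auto split: if_splits)
  then have "card (states N \<inter> {s. \<forall>a\<in>A. s a = z a}) = (\<Prod>i\<in>{1..N}. if i \<in> A then 1 else 2)"
    by (simp add: card_PiE) (intro prod.cong, auto)
  also have "\<dots> = 2 ^ card ({1..N} - A)"
    using assms by (simp add: prod.If_cases Diff_eq Collect_neg_eq)
  finally have c: "card (states N \<inter> {s. \<forall>a\<in>A. s a = z a}) = 2 ^ card ({1..N} - A)" .
  have "card ({1..N} - A) + card A = N"
    using assms fin card_Diff_subset[OF fin assms] card_mono[OF _ assms] by simp
  then have "(2 :: real) ^ N = 2 ^ card ({1..N} - A) * 2 ^ card A" by (metis power_add)
  then show ?thesis unfolding prob_states_eq c by simp
qed

lemma prob_states_compl: "prob_states N X = 1 - prob_states N (- X)"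
  using measure_pmf.prob_compl[of X "pmf_of_set (states N)"] by (simp add: Compl_eq_Diff_UNIV)

lemma prob_states_lower:
  assumes "prob_states N (- X) \<le> e"
  shows "1 - e \<le> prob_states N X"
  using assms prob_states_compl[of N X] by linarith

lemma prob_states_mono:
  "(\<And>s. s \<in> states N \<Longrightarrow> s \<in> X \<Longrightarrow> s \<in> Y) \<Longrightarrow> prob_states N X \<le> prob_states N Y"
  unfolding prob_states_eq by (intro divide_right_mono) (auto intro!: card_mono finite_Int finite_states)

lemma pair_pmf_of_set:
  assumes "finite A" "A \<noteq> {}" "finite B" "B \<noteq> {}"
  shows "pair_pmf (pmf_of_set A) (pmf_of_set B) = pmf_of_set (A \<times> B)"
proof (rule pmf_eqI)
  fix z
  show "pmf (pair_pmf (pmf_of_set A) (pmf_of_set B)) z = pmf (pmf_of_set (A \<times> B)) z"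
    using assms by (cases z) (simp add: pmf_pair card_cartesian_product indicator_times)
qed

text \<open>
  It suffices to treat each flipped coordinate in a large set \<open>C\<close> separately.
\<close>

lemma prob_flip_ge:
  assumes C: "C \<subseteq> {1..N}" "0 < N"
    and g: "\<And>i. i \<in> C \<Longrightarrow> g \<le> prob_states N {s. (s, i) \<in> E}"
  shows "real (card C) / N * g \<le>
    measure_pmf.prob (pair_pmf (pmf_of_set (states N)) (pmf_of_set {1..N})) E"
proof -
  have ne: "{1..N} \<noteq> {}" using C by auto
  have fin: "finite C" using C finite_subset by blast
  have pair: "pair_pmf (pmf_of_set (states N)) (pmf_of_set {1..N}) = pmf_of_set (states N \<times> {1..N})"
    by (rule pair_pmf_of_set) (use ne in \<open>auto simp: finite_states states_nonempty\<close>)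
  have "g * 2 ^ N \<le> card (states N \<inter> {s. (s, i) \<in> E})" if "i \<in> C" for i
    using g[OF that] unfolding prob_states_eq by (simp add: field_simps)
  then have "(\<Sum>i\<in>C. g * 2 ^ N) \<le> (\<Sum>i\<in>C. real (card (states N \<inter> {s. (s, i) \<in> E})))"
    by (rule sum_mono)
  also have "\<dots> = card (SIGMA i:C. states N \<inter> {s. (s, i) \<in> E})"
    using fin finite_states by (subst card_SigmaI) auto
  also have "\<dots> = card ((\<lambda>(i, s). (s, i)) ` (SIGMA i:C. states N \<inter> {s. (s, i) \<in> E}))"
    by (subst card_image) (auto simp: inj_on_def)
  also have "\<dots> \<le> card ((states N \<times> {1..N}) \<inter> E)"
    using C by (intro of_nat_mono card_mono) (auto intro!: finite_Int simp: finite_states)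
  finally show ?thesis
    unfolding pair using C ne
    by (subst measure_pmf_of_set)
      (auto simp: finite_states states_nonempty card_cartesian_product card_states field_simps)
qed

text \<open>
  This is the variance of the weight of a random bit string, computed from
  \<open>(d - 1)\<^sup>2 + (d + 1)\<^sup>2 = 2 * d\<^sup>2 + 2\<close>.
\<close>

lemma sum_weight_deviation:
  "(\<Sum>S\<in>Pow {..<n}. (2 * real (card S) - real n)\<^sup>2) = real n * 2 ^ n"
proof (induction n)
  case 0
  then show ?case by simp
next
  case (Suc n)
  have fin: "finite S" "n \<notin> S" if "S \<in> Pow {..<n}" for S using that finite_subset by auto
  have inj: "inj_on (insert n) (Pow {..<n})" by (auto simp: inj_on_def insert_ident)
  have "(\<Sum>S\<in>Pow {..<Suc n}. (2 * real (card S) - real (Suc n))\<^sup>2) =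
      (\<Sum>S\<in>Pow {..<n}. (2 * real (card S) - real (Suc n))\<^sup>2)
      + (\<Sum>S\<in>insert n ` Pow {..<n}. (2 * real (card S) - real (Suc n))\<^sup>2)"
    unfolding lessThan_Suc Pow_insert by (rule sum.union_disjoint) auto
  also have "\<dots> = (\<Sum>S\<in>Pow {..<n}. (2 * real (card S) - real (Suc n))\<^sup>2
      + (2 * real (card (insert n S)) - real (Suc n))\<^sup>2)"
    by (simp add: sum.reindex[OF inj] sum.distrib)
  also have "\<dots> = (\<Sum>S\<in>Pow {..<n}. 2 * (2 * real (card S) - real n)\<^sup>2 + 2)"
    using fin by (intro sum.cong) (auto simp: power2_eq_square algebra_simps)
  also have "\<dots> = real (Suc n) * 2 ^ Suc n"
    using Suc by (simp add: sum.distrib sum_distrib_left[symmetric] card_Pow algebra_simps)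
  finally show ?case .
qed

text \<open>
  Chebyshev's inequality.
\<close>

lemma card_unbalanced:
  assumes "0 < R"
  shows "real (card {S. S \<subseteq> {..<2 * M} \<and> \<not> (M < card S + R \<and> card S < M + R)})
    \<le> M / (2 * real R ^ 2) * 2 ^ (2 * M)"
proof -
  define U where "U = {S. S \<subseteq> {..<2 * M} \<and> \<not> (M < card S + R \<and> card S < M + R)}"
  have U: "U \<subseteq> Pow {..<2 * M}" by (auto simp: U_def)
  have dev: "(2 * real R)\<^sup>2 \<le> (2 * real (card S) - real (2 * M))\<^sup>2" if "S \<in> U" for S
  proof -
    have "2 * real R \<le> \<bar>2 * real (card S) - real (2 * M)\<bar>" using that by (auto simp: U_def)
    then have "\<bar>2 * real R\<bar> \<le> \<bar>2 * real (card S) - real (2 * M)\<bar>" by simp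
    then show ?thesis by (rule abs_le_square_iff[THEN iffD1])
  qed
  have "card U * (2 * real R)\<^sup>2 = (\<Sum>S\<in>U. (2 * real R)\<^sup>2)" by simp
  also have "\<dots> \<le> (\<Sum>S\<in>U. (2 * real (card S) - real (2 * M))\<^sup>2)" by (rule sum_mono) (rule dev)
  also have "\<dots> \<le> (\<Sum>S\<in>Pow {..<2 * M}. (2 * real (card S) - real (2 * M))\<^sup>2)"
    using U by (intro sum_mono2) auto
  also have "\<dots> = real (2 * M) * 2 ^ (2 * M)" by (rule sum_weight_deviation)
  finally show ?thesis using assms unfolding U_def by (simp add: field_simps power2_eq_square)
qed

context counter_machine
begin

text \<open>
  At each time before \<open>K\<close>, one of the \<open>v\<close> lines of kind \<open>b\<close> has \<open>\<not> b\<close> in its window of initial cells, and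
  so does not yet deliver \<open>b\<close>.
\<close>

definition clean :: "bool \<Rightarrow> state \<Rightarrow> bool" where
  "clean b s \<longleftrightarrow> (\<forall>t<K. \<exists>j<v. \<exists>k. K \<le> k + 2 * t + 1 \<and> k + t + 1 \<le> K \<and> s (idx (Line (bw b j) k)) \<noteq> b)"

lemma role_bw: "j < v \<Longrightarrow> role (bw b j) = Fill b" and delay_bw: "delay (bw b j) = K"
  by (auto simp: role_def bw_def delay_def)

lemma sig_fill:
  assumes "j < v"
  shows "sig s t (bw b j) = b \<longleftrightarrow>
    (\<forall>k. K \<le> k + 2 * t + 1 \<longrightarrow> k + t + 1 \<le> K \<longrightarrow> s (idx (Line (bw b j) k)) = b)"
proof -
  have eq: "(K - 1 \<le> k + 2 * t) = (K \<le> k + 2 * t + 1)" "(k + t \<le> K - 1) = (k + t + 1 \<le> K)" for k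
    using K_large by auto
  have "sig s t (bw b j) = b \<longleftrightarrow>
      (\<forall>k. K - 1 \<le> k + 2 * t \<longrightarrow> k + t \<le> K - 1 \<longrightarrow> s (idx (Line (bw b j) k)) = b)"
    unfolding sig_def delay_bw
    by (rule Line_fill) (use assms K_large in \<open>simp_all add: role_bw delay_bw\<close>)
  then show ?thesis unfolding eq .
qed

lemma clean_booted:
  assumes "clean True s" "clean False s"
  shows "booted s"
proof -
  have all: "(\<forall>j<v. sig s t (bw b j) = b) \<longleftrightarrow> K \<le> t" if "clean b s" for b t
  proof
    assume "\<forall>j<v. sig s t (bw b j) = b"
    then show "K \<le> t" using that unfolding clean_def by (metis sig_fill not_less)
  next
    assume "K \<le> t"
    then show "\<forall>j<v. sig s t (bw b j) = b" by (simp add: sig_fill)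
  qed
  show ?thesis
    using all[OF assms(1)] all[OF assms(2)] unfolding booted_def running_def booting_def
    by (metis (full_types) not_less)
qed

text \<open>
  At time \<open>t\<close> the window has \<open>min (t + 1) (K - t)\<close> cells on each of \<open>v\<close> lines, so it is filled with
  \<open>b\<close> with probability \<open>x ^ min (t + 1) (K - t)\<close>, where \<open>x = 1 / 2 ^ v\<close>.  The sum over \<open>t\<close> consists of
  two geometric series, which makes the bound independent of \<open>K\<close>.
\<close>

lemma prob_not_clean:
  assumes "0 < v"
  shows "prob_states N {s. \<not> clean b s} \<le> 4 / 2 ^ v"
proof -
  define x :: real where "x = 1 / 2 ^ v"
  have "(2 :: real) ^ 1 \<le> 2 ^ v" using assms by (intro power_increasing) auto
  then have x: "0 < x" "x \<le> 1 / 2" by (auto simp: x_def field_simps)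
  define P where "P t = {s :: state. \<forall>j<v. \<forall>k. K \<le> k + 2 * t + 1 \<longrightarrow> k + t + 1 \<le> K \<longrightarrow>
      s (idx (Line (bw b j) k)) = b}" for t
  have P: "prob_states N (P t) \<le> x ^ Suc t + x ^ (K - t)" if t: "t < K" for t
  proof -
    define I where "I = {K - 1 - 2 * t..K - 1 - t}"
    define C where "C = (\<lambda>(j, k). Line (bw b j) k) ` ({..<v} \<times> I)"
    have C: "C \<subseteq> cells" using t by (auto simp: C_def I_def delay_bw)
    have "inj_on (\<lambda>(j, k). Line (bw b j) k) ({..<v} \<times> I)" by (auto simp: inj_on_def bw_def)
    then have "card C = v * card I" by (simp add: C_def card_image card_cartesian_product)
    moreover have "inj_on idx C" using C idx_cells by (meson bij_betw_def inj_on_subset)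
    ultimately have card: "card (idx ` C) = v * card I" by (simp add: card_image)
    have I: "k \<in> I \<longleftrightarrow> K \<le> k + 2 * t + 1 \<and> k + t + 1 \<le> K" for k
      using t by (auto simp: I_def)
    have "P t = {s. \<forall>j<v. \<forall>k\<in>I. s (idx (Line (bw b j) k)) = b}"
      unfolding P_def Ball_def I by (simp add: imp_conjL)
    then have "P t = {s. \<forall>a\<in>idx ` C. s a = b}" by (auto simp: C_def)
    moreover have "idx ` C \<subseteq> {1..N}" using C idx_in by blast
    ultimately have "prob_states N (P t) = 1 / 2 ^ card (idx ` C)"
      using prob_prescribed[of "idx ` C" N "\<lambda>_. b"] by simp
    also have "\<dots> = x ^ card I" unfolding card x_def by (simp add: power_mult power_one_over)
    also have "card I = min (Suc t) (K - t)" using t by (auto simp: I_def)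
    also have "x ^ min (Suc t) (K - t) \<le> x ^ Suc t + x ^ (K - t)" using x by (simp add: min_def)
    finally show ?thesis .
  qed
  have geo: "(\<Sum>t<K. x ^ Suc t) \<le> 2 * x"
  proof -
    have "(\<Sum>t<K. x ^ t) = (1 - x ^ K) / (1 - x)" using x by (subst sum_gp_strict) auto
    also have "\<dots> \<le> 1 / (1 - x)" using x by (intro divide_right_mono) auto
    also have "\<dots> \<le> 2" using x by (simp add: field_simps)
    finally have "x * (\<Sum>t<K. x ^ t) \<le> x * 2" using x by (intro mult_left_mono) auto
    then show ?thesis by (simp add: sum_distrib_left mult.commute)
  qed
  have geo': "(\<Sum>t<K. x ^ (K - t)) = (\<Sum>t<K. x ^ Suc t)"
    by (rule sum.reindex_bij_witness[of _ "\<lambda>t. K - 1 - t" "\<lambda>t. K - 1 - t"])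
      (auto simp: Suc_diff_Suc simp flip: power_Suc)
  have "{s. \<not> clean b s} = (\<Union>t\<in>{..<K}. P t)"
    unfolding clean_def P_def by auto
  then have "prob_states N {s. \<not> clean b s} \<le> (\<Sum>t<K. prob_states N (P t))"
    by (simp add: measure_pmf.finite_measure_subadditive_finite)
  also have "\<dots> \<le> (\<Sum>t<K. x ^ Suc t + x ^ (K - t))" by (rule sum_mono) (use P in auto)
  also have "\<dots> \<le> 4 * x" using geo geo' by (simp add: sum.distrib)
  finally show ?thesis by (simp add: x_def)
qed

definition balanced :: "nat \<Rightarrow> state \<Rightarrow> bool" where
  "balanced p s \<longleftrightarrow> M < card (column s p) + R \<and> card (column s p) < M + R"

lemma prob_unbalanced:
  assumes "p < K - lat" "0 < R"
  shows "prob_states N {s. \<not> balanced p s} \<le> M / (2 * real R ^ 2)"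
proof -
  define U where "U = {S. S \<subseteq> {..<2 * M} \<and> \<not> (M < card S + R \<and> card S < M + R)}"
  define P where "P S = {s. column s p = S}" for S
  have L: "{..<2 * M} = {..<L}" by (simp add: L_def)
  have fin: "finite U" by (rule finite_subset[of _ "Pow {..<2 * M}"]) (auto simp: U_def)
  have P: "prob_states N (P S) = 1 / 2 ^ (2 * M)" if "S \<subseteq> {..<L}" for S
  proof -
    define C where "C = (\<lambda>j. Line j p) ` {..<L}"
    have C: "C \<subseteq> cells" using assms by (auto simp: C_def delay_def lat_eq)
    have inj: "inj_on idx C" using C idx_cells by (meson bij_betw_def inj_on_subset)
    have card: "card (idx ` C) = 2 * M"
      unfolding card_image[OF inj] unfolding C_def by (subst card_image) (auto simp: inj_on_def L_def)
    define z where "z a = (inv_into C idx a \<in> (\<lambda>j. Line j p) ` S)" for a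
    have z: "z (idx (Line j p)) \<longleftrightarrow> j \<in> S" if "j < L" for j
    proof -
      have "inv_into C idx (idx (Line j p)) = Line j p"
        using that inj by (intro inv_into_f_f) (auto simp: C_def)
      then show ?thesis by (auto simp: z_def)
    qed
    have "P S = {s. \<forall>j<L. s (idx (Line j p)) \<longleftrightarrow> j \<in> S}"
      using that unfolding P_def column_def by blast
    also have "\<dots> = {s. \<forall>a\<in>idx ` C. s a = z a}" using z by (auto simp: C_def)
    finally have "P S = {s. \<forall>a\<in>idx ` C. s a = z a}" .
    moreover have "idx ` C \<subseteq> {1..N}" using C idx_in by blast
    ultimately show ?thesis using prob_prescribed[of "idx ` C" N z] card by simp
  qed
  have "{s. \<not> balanced p s} = (\<Union>S\<in>U. P S)"
    unfolding balanced_def U_def P_def L by (auto simp: column_def)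
  then have "prob_states N {s. \<not> balanced p s} \<le> (\<Sum>S\<in>U. prob_states N (P S))"
    using fin by (simp add: measure_pmf.finite_measure_subadditive_finite)
  also have "\<dots> = card U / 2 ^ (2 * M)"
    using P by (simp add: U_def L)
  also have "\<dots> \<le> M / (2 * real R ^ 2)"
    using card_unbalanced[OF assms(2), of M] unfolding U_def by (simp add: field_simps)
  finally show ?thesis .
qed

lemma prob_not_clean_both:
  assumes "0 < v"
  shows "prob_states N ({s. \<not> clean True s} \<union> {s. \<not> clean False s}) \<le> 8 / 2 ^ v"
proof -
  have "prob_states N ({s. \<not> clean True s} \<union> {s. \<not> clean False s})
      \<le> prob_states N {s. \<not> clean True s} + prob_states N {s. \<not> clean False s}"
    by (rule measure_Un_le) auto
  also have "\<dots> \<le> 4 / 2 ^ v + 4 / 2 ^ v"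
    by (intro add_mono prob_not_clean assms)
  finally show ?thesis by simp
qed

lemma chaotic_net:
  assumes "0 < v" "p < 1 - 8 / 2 ^ v" "c ^ N < real (B ^ (K - lat - 2))"
  shows "chaotic p c N net"
proof -
  define X where "X = {s. \<exists>A\<in>attractors N net. s \<in> basin N net A \<and> c ^ N < real (card A)}"
  have "prob_states N (- X) \<le> prob_states N ({s. \<not> clean True s} \<union> {s. \<not> clean False s})"
  proof (rule prob_states_mono, rule ccontr)
    fix s assume s: "s \<in> states N" "s \<in> - X" "s \<notin> {s. \<not> clean True s} \<union> {s. \<not> clean False s}"
    then have b: "booted s" using clean_booted by blast
    obtain A where A: "A \<in> attractors N net" "s \<in> basin N net A"
      using ex_attractor[OF boolean_network_net s(1)] by blast
    have "B ^ (K - lat - 2) \<le> card A"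
    proof (rule card_attractor_ge[OF boolean_network_net A])
      fix a b assume "a < b" "(net ^^ a) s = (net ^^ b) s"
      then show "B ^ (K - lat - 2) \<le> b - a"
        using dvd_imp_le[OF booted_period[OF \<open>booted s\<close>, of a b]] by simp
    qed
    then have "real (B ^ (K - lat - 2)) \<le> real (card A)" by (rule of_nat_mono)
    then have "c ^ N < real (card A)" using assms(3) by linarith
    then show False using A s(2) unfolding X_def by blast
  qed
  also have "\<dots> \<le> 8 / 2 ^ v" by (rule prob_not_clean_both[OF assms(1)])
  finally have "p < prob_states N X"
    by (rule less_le_trans[OF assms(2) prob_states_lower])
  then show ?thesis unfolding chaotic_def X_def .
qed

text \<open>
  A flip in a data wire leaves the boot wires alone, so the states before and after the flip
  boot together.
\<close>

lemma clean_cong: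
  assumes "clean b s" and eq: "\<And>j k. j < v \<Longrightarrow> k < K \<Longrightarrow> s' (idx (Line (bw b j) k)) = s (idx (Line (bw b j) k))"
  shows "clean b s'"
  unfolding clean_def
proof (intro allI impI)
  fix t assume t: "t < K"
  obtain j k where "j < v" "K \<le> k + 2 * t + 1" "k + t + 1 \<le> K" "s (idx (Line (bw b j) k)) \<noteq> b"
    using assms(1)[unfolded clean_def, rule_format, OF t] by (elim exE conjE)
  moreover from this have "s' (idx (Line (bw b j) k)) \<noteq> b" using eq[of j k] by simp
  ultimately show "\<exists>j<v. \<exists>k. K \<le> k + 2 * t + 1 \<and> k + t + 1 \<le> K \<and> s' (idx (Line (bw b j) k)) \<noteq> b"
    by (intro exI conjI)
qed

lemma clean_flip:
  assumes "j < L" "p < K - lat" "clean b s"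
  shows "clean b (flip (idx (Line j p)) s)"
proof (rule clean_cong[OF assms(3)])
  fix j' k assume jk: "j' < v" "k < K"
  have "Line j p \<in> cells" using assms(1,2) by (simp add: delay_def lat_eq)
  moreover have "Line (bw b j') k \<in> cells" using jk by (simp add: delay_bw)
  moreover have "Line (bw b j') k \<noteq> Line j p" using assms(1) by (auto simp: bw_def)
  ultimately show "flip (idx (Line j p)) s (idx (Line (bw b j') k)) = s (idx (Line (bw b j') k))"
    by (simp add: flip_def idx_eq_iff)
qed

lemma unstable_net:
  assumes "0 < v" "0 < R" "0 < N"
    and p: "p \<le> real (L * (K - lat)) / N * (1 - 8 / 2 ^ v - M / (2 * real R ^ 2))"
  shows "unstable p N net"
proof -
  define E where "E = {(s, i). \<exists>A\<in>attractors N net. \<exists>B\<in>attractors N net.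
    A \<noteq> B \<and> s \<in> basin N net A \<and> flip i s \<in> basin N net B}"
  define C where "C = (\<lambda>(j, p). Line j p) ` ({..<L} \<times> {..<K - lat})"
  have C: "C \<subseteq> cells" by (auto simp: C_def delay_def lat_eq)
  have "inj_on idx C" using C idx_cells by (meson bij_betw_def inj_on_subset)
  then have "card (idx ` C) = card C" by (rule card_image)
  also have "\<dots> = L * (K - lat)"
    unfolding C_def by (subst card_image) (auto simp: inj_on_def card_cartesian_product)
  finally have card: "card (idx ` C) = L * (K - lat)" .
  have good: "1 - 8 / 2 ^ v - M / (2 * real R ^ 2) \<le> prob_states N {s. (s, i) \<in> E}"
    if "i \<in> idx ` C" for i
  proof -
    from that obtain u where u: "u \<in> {..<L} \<times> {..<K - lat}" "i = idx ((\<lambda>(j, p). Line j p) u)"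
      unfolding C_def by blast
    obtain j q where "u = (j, q)" by (cases u)
    with u have i: "i = idx (Line j q)" "j < L" "q < K - lat" by simp_all
    have "prob_states N (- {s. (s, i) \<in> E}) \<le>
        prob_states N ({s. \<not> clean True s} \<union> {s. \<not> clean False s} \<union> {s. \<not> balanced q s})"
    proof (rule prob_states_mono, rule ccontr)
      fix s assume s: "s \<in> states N" "s \<in> - {s. (s, i) \<in> E}"
        "s \<notin> {s. \<not> clean True s} \<union> {s. \<not> clean False s} \<union> {s. \<not> balanced q s}"
      then have "booted s" "booted (flip (idx (Line j q)) s)"
        using clean_booted clean_flip[OF i(2,3)] by auto
      from flip_changes_attractor[OF s(1) i(2,3) this] s(2,3) show False
        unfolding balanced_def E_def i by auto
    qed
    also have "\<dots> \<le> prob_states N ({s. \<not> clean True s} \<union> {s. \<not> clean False s}) + prob_states N {s. \<not> balanced q s}"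
      by (rule measure_Un_le) auto
    also have "\<dots> \<le> 8 / 2 ^ v + M / (2 * real R ^ 2)"
      by (rule add_mono[OF prob_not_clean_both[OF assms(1)] prob_unbalanced[OF i(3) assms(2)]])
    finally have "1 - (8 / 2 ^ v + M / (2 * real R ^ 2)) \<le> prob_states N {s. (s, i) \<in> E}"
      by (rule prob_states_lower)
    then show ?thesis by (simp only: diff_diff_eq)
  qed
  have "p \<le> real (card (idx ` C)) / N * (1 - 8 / 2 ^ v - M / (2 * real R ^ 2))" using p card by simp
  also have "\<dots> \<le> measure_pmf.prob (pair_pmf (pmf_of_set (states N)) (pmf_of_set {1..N})) E"
    by (rule prob_flip_ge) (use C idx_in good assms in auto)
  finally show ?thesis unfolding unstable_def E_def .
qed

end

section \<open>The size of the network and the choice of parameters\<close>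

definition circuit_cells :: "nat \<Rightarrow> cell set" where
  "circuit_cells n = {Fan i l k | i l k. i < n \<and> l \<le> 3 * n \<and> k < 2 ^ l}
     \<union> {Node i l k | i l k. i < n \<and> l \<le> 2 * n \<and> k < 2 ^ l}"

lemma finite_circuit_cells: "finite (circuit_cells n)"
proof -
  have "circuit_cells n \<subseteq>
      (\<lambda>(i, l, k). Fan i l k) ` ({..<n} \<times> {..3 * n} \<times> {..2 ^ (3 * n)})
      \<union> (\<lambda>(i, l, k). Node i l k) ` ({..<n} \<times> {..2 * n} \<times> {..2 ^ (2 * n)})"
  proof
    fix u assume "u \<in> circuit_cells n"
    then consider i l k where "u = Fan i l k" "i < n" "l \<le> 3 * n" "k < 2 ^ l"
      | i l k where "u = Node i l k" "i < n" "l \<le> 2 * n" "k < 2 ^ l"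
      unfolding circuit_cells_def by blast
    then show "u \<in> (\<lambda>(i, l, k). Fan i l k) ` ({..<n} \<times> {..3 * n} \<times> {..2 ^ (3 * n)})
      \<union> (\<lambda>(i, l, k). Node i l k) ` ({..<n} \<times> {..2 * n} \<times> {..2 ^ (2 * n)})"
    proof cases
      case (1 i l k)
      then have "k \<le> 2 ^ (3 * n)" using power_increasing[of l "3 * n" "2 :: nat"] by linarith
      then show ?thesis using 1 by (intro UnI1 image_eqI[of _ _ "(i, l, k)"]) auto
    next
      case (2 i l k)
      then have "k \<le> 2 ^ (2 * n)" using power_increasing[of l "2 * n" "2 :: nat"] by linarith
      then show ?thesis using 2 by (intro UnI2 image_eqI[of _ _ "(i, l, k)"]) auto
    qed
  qed
  then show ?thesis by (rule finite_subset) auto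
qed

context delay_machine
begin

lemma cells_eq:
  "cells = (\<lambda>(i, p). Line i p) ` (SIGMA i:{..<n}. {..<len i}) \<union> circuit_cells n \<union> Pad ` {..<pad}"
  unfolding cells_def circuit_cells_def by auto

lemma card_cells:
  "finite cells" "card cells = (\<Sum>i<n. len i) + card (circuit_cells n) + pad"
proof -
  let ?lines = "(\<lambda>(i, p). Line i p) ` (SIGMA i:{..<n}. {..<len i})"
  show "finite cells" unfolding cells_eq using finite_circuit_cells by auto
  have "card ?lines = (\<Sum>i<n. len i)"
    by (subst card_image) (auto simp: inj_on_def card_SigmaI)
  moreover have "card (Pad ` {..<pad}) = pad" by (subst card_image) (auto simp: inj_on_def)
  moreover have "card (?lines \<union> circuit_cells n) = card ?lines + card (circuit_cells n)"
    by (rule card_Un_disjoint) (auto simp: finite_circuit_cells, auto simp: circuit_cells_def)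
  moreover have "card cells = card (?lines \<union> circuit_cells n) + card (Pad ` {..<pad})"
    unfolding cells_eq
    by (rule card_Un_disjoint) (auto simp: finite_circuit_cells, auto simp: circuit_cells_def)
  ultimately show "card cells = (\<Sum>i<n. len i) + card (circuit_cells n) + pad" by simp
qed

end

lemma (in counter_params) sum_delay: "(\<Sum>i<width. delay i) \<le> (2 * M + 2 * R + 3 + 2 * v) * K + 2"
proof -
  have split: "{..<width} = {..<L + W + 2} \<union> {L + W + 2..<L + W + 4} \<union> {L + W + 4..<width}"
    by (auto simp: width_def)
  have "(\<Sum>i<width. delay i) = (\<Sum>i<L + W + 2. delay i) + (\<Sum>i\<in>{L + W + 2..<L + W + 4}. delay i)
      + (\<Sum>i\<in>{L + W + 4..<width}. delay i)"
    unfolding split by (subst sum.union_disjoint, auto)+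
  also have "\<dots> \<le> (\<Sum>i<L + W + 2. K) + (\<Sum>i\<in>{L + W + 2..<L + W + 4}. 1) + (\<Sum>i\<in>{L + W + 4..<width}. K)"
    by (intro add_mono sum_mono) (auto simp: delay_def)
  also have "\<dots> = (2 * M + 2 * R + 3 + 2 * v) * K + 2"
    by (simp add: width_def L_def W_def algebra_simps)
  finally show ?thesis .
qed

text \<open>
  The network for given numerical parameters.  The cells of the form \<open>Pad k\<close> bring the number of
  variables up to exactly \<open>N\<close>.  The size hypothesis charges delay \<open>K\<close> to the data, storage, carry and
  boot wires, \<open>2 * M + (2 * R + 1) + 2 + 2 * v\<close> in number.
\<close>

lemma counter_network:
  fixes p c :: real and M R v K N :: nat
  defines "w \<equiv> 2 * M + 2 * R + 5 + 2 * v"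
  assumes pos: "0 < v" "0 < R" "1 \<le> N"
    and large: "5 * w + 4 < K" and c1: "1 \<le> c"
    and c: "c ^ N < real ((2 * M choose M) - 1) ^ (K - 5 * w - 4)"
    and size: "(2 * M + 2 * R + 3 + 2 * v) * K + 2 + card (circuit_cells w) \<le> N"
    and p1: "p < 1 - 8 / 2 ^ v"
    and p2: "p \<le> real (2 * M * (K - 5 * w - 2)) / N * (1 - 8 / 2 ^ v - M / (2 * real R ^ 2))"
  shows "\<exists>f. boolean_network N f \<and> biquadratic N f \<and> cooperative N f \<and> chaotic p c N f \<and> unstable p N f"
proof -
  define B where "B = (2 * M choose M) - 1"
  have "1 \<le> c ^ N" using c1 by simp
  then have "0 < real B ^ (K - 5 * w - 4)" using c unfolding B_def by linarith
  then have "B \<noteq> 0 \<or> K - 5 * w - 4 = 0" by (cases "B = 0") (auto simp: power_0_left split: if_splits)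
  then have B: "0 < B" using large by auto
  have "card {S. S \<subseteq> {..<2 * M} \<and> card S = M} = card {..B}"
    using n_subsets[of "{..<2 * M}" M] B by (simp add: B_def)
  then obtain enc where enc: "bij_betw enc {..B} {S. S \<subseteq> {..<2 * M} \<and> card S = M}"
    using finite_same_card_bij[of "{..B}" "{S. S \<subseteq> {..<2 * M} \<and> card S = M}"] by auto
  have w: "counter_params.width M R v = w"
    by (simp add: counter_params.width_def counter_params.L_def counter_params.W_def w_def)
  define pad where
    "pad = N - ((\<Sum>i<w. counter_params.delay M R v K i) + card (circuit_cells w))"
  interpret counter_layout M R v K B enc pad
    by unfold_locales (use large w in simp)
  have "card cells = N"
    using card_cells(2) sum_delay size unfolding w pad_def by linarith
  then obtain idx where idx: "bij_betw idx cells {1..N}"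
    using finite_same_card_bij[OF card_cells(1), of "{1..N}"] by auto
  interpret counter_machine M R v K B enc pad idx N
    by unfold_locales (use enc idx B in \<open>simp_all add: L_def\<close>)
  have lat: "lat = 5 * w + 2" using lat_eq unfolding w .
  have "K - lat - 2 = K - 5 * w - 4" using lat by simp
  then have "chaotic p c N net"
    using chaotic_net[OF pos(1) p1] c by (simp add: B_def)
  moreover have "unstable p N net"
    by (rule unstable_net) (use pos p2 in \<open>simp_all add: lat L_def\<close>)
  ultimately show ?thesis
    using boolean_network_net biquadratic_net cooperative_net by blast
qed

text \<open>
  With \<open>R\<close> about \<open>\<eta> * M\<close>, the number \<open>a\<close> of long wires is about \<open>2 * (1 + \<eta>) * M\<close>.  The base of the odometer
  is at least \<open>4 ^ M / (2 * M) - 1\<close>, which exceeds \<open>c ^ a\<close> for large \<open>M\<close> as soon as \<open>(1 + \<eta>) * ln c < ln 2\<close>.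
  The fraction of data wires is about \<open>1 / (1 + \<eta>)\<close>, and Chebyshev's bound is of order \<open>1 / M\<close>.
\<close>

lemma ex_block_size:
  fixes c q :: real and v :: nat
  assumes c: "1 < c" "c < 2" and q: "0 < q" "q < 1"
  shows "\<exists>M R. 0 < R \<and> M / (2 * real R ^ 2) \<le> q
    \<and> (1 - q) * (2 * M + 2 * R + 3 + 2 * v) < 2 * M
    \<and> c ^ (2 * M + 2 * R + 3 + 2 * v) < real ((2 * M choose M) - 1)"
proof -
  have lnc: "0 < ln c" "ln c < ln 2" using c by auto
  define g where "g = ln 2 / ln c - 1"
  define \<eta> where "\<eta> = min q (g / 2)"
  have "0 < g" using lnc by (simp add: g_def)
  then have \<eta>: "0 < \<eta>" "\<eta> \<le> q" "\<eta> < g" using q by (auto simp: \<eta>_def)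
  have \<delta>: "0 < 2 * (ln 2 - (1 + \<eta>) * ln c)" using \<eta>(3) lnc by (simp add: g_def field_simps)
  define \<delta> where "\<delta> = 2 * (ln 2 - (1 + \<eta>) * ln c)"
  define \<beta> where "\<beta> = (5 + 2 * real v) * ln c"
  define \<gamma> where "\<gamma> = 2 - (1 - q) * (2 + 2 * \<eta>)"
  have "(1 - q) * (1 + \<eta>) \<le> (1 - q) * (1 + q)" using \<eta> q by (intro mult_left_mono) auto
  also have "\<dots> < 1" using q by (simp add: algebra_simps)
  finally have \<gamma>: "0 < \<gamma>" by (simp add: \<gamma>_def algebra_simps)
  have "0 < \<delta>" using \<delta> by (simp add: \<delta>_def)
  have "\<forall>\<^sub>F M in sequentially. 1 / (2 * \<eta>\<^sup>2 * real M) < q"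
    using \<eta>(1) q by real_asymp
  moreover have "\<forall>\<^sub>F M in sequentially. (1 - q) * (5 + 2 * real v) < \<gamma> * real M"
    using \<gamma> by real_asymp
  moreover
  have decay: "\<forall>\<^sub>F M in sequentially. C * (real M * exp (- (d * real M))) < 1 / 2"
    if "0 < C" "0 < d" for C d :: real
    using that by real_asymp
  have d1: "\<forall>\<^sub>F M in sequentially. 2 * exp \<beta> * (real M * exp (- (\<delta> * real M))) < 1 / 2"
    by (rule decay) (use \<open>0 < \<delta>\<close> in auto)
  have d2: "\<forall>\<^sub>F M in sequentially. 2 * (real M * exp (- (ln 4 * real M))) < 1 / 2"
    by (rule decay) auto
  have "\<forall>\<^sub>F M in sequentially.
      2 * real M * exp (\<beta> - \<delta> * real M) + 2 * real M * exp (- ln 4 * real M) < 1"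
    using d1 d2
  proof eventually_elim
    case (elim M)
    have "exp (\<beta> - \<delta> * real M) = exp \<beta> * exp (- (\<delta> * real M))" by (simp flip: exp_add)
    then have "2 * real M * exp (\<beta> - \<delta> * real M) = 2 * exp \<beta> * (real M * exp (- (\<delta> * real M)))"
      by simp
    moreover have "2 * real M * exp (- ln 4 * real M) = 2 * (real M * exp (- (ln 4 * real M)))"
      by simp
    ultimately show ?case using elim by linarith
  qed
  ultimately have "\<forall>\<^sub>F M in sequentially. 0 < M \<and> 1 / (2 * \<eta>\<^sup>2 * real M) < q
      \<and> (1 - q) * (5 + 2 * real v) < \<gamma> * real M
      \<and> 2 * real M * exp (\<beta> - \<delta> * real M) + 2 * real M * exp (- ln 4 * real M) < 1"
    using eventually_gt_at_top[of "0 :: nat"] by eventually_elim simp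
  then obtain M :: nat where M: "0 < M" "1 / (2 * \<eta>\<^sup>2 * real M) < q"
    "(1 - q) * (5 + 2 * real v) < \<gamma> * real M"
    "2 * real M * exp (\<beta> - \<delta> * real M) + 2 * real M * exp (- ln 4 * real M) < 1"
    using eventually_happens'[OF sequentially_bot] by blast
  define R where "R = nat \<lceil>\<eta> * M\<rceil>"
  have R: "\<eta> * M \<le> real R" "real R \<le> \<eta> * M + 1" using \<eta> by (auto simp: R_def)
  then have Rpos: "0 < R" using \<eta> M(1) by (metis gr0I mult_pos_pos not_less of_nat_0 of_nat_0_less_iff)
  define a where "a = 2 * M + 2 * R + 3 + 2 * v"
  have a: "real a \<le> 2 * (1 + \<eta>) * M + (5 + 2 * real v)" using R by (simp add: a_def algebra_simps)
  have "M / (2 * real R ^ 2) \<le> M / (2 * (\<eta> * M) ^ 2)"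
    using R(1) Rpos \<eta>(1) M(1) by (intro divide_left_mono mult_left_mono power_mono mult_pos_pos zero_less_power) auto
  also have "\<dots> = 1 / (2 * \<eta>\<^sup>2 * real M)" using M(1) by (simp add: power2_eq_square field_simps)
  finally have 1: "M / (2 * real R ^ 2) \<le> q" using M(2) by linarith
  have "(1 - q) * a \<le> (1 - q) * (2 * (1 + \<eta>) * M + (5 + 2 * real v))"
    using a q by (intro mult_left_mono) auto
  also have "\<dots> < 2 * M" using M(3) by (simp add: \<gamma>_def algebra_simps)
  finally have 2: "(1 - q) * a < 2 * M" .
  have "c ^ a = exp (a * ln c)" using c by (simp add: exp_of_nat_mult)
  also have "\<dots> \<le> exp ((2 * (1 + \<eta>) * M + (5 + 2 * real v)) * ln c)"
    using a lnc by (subst exp_le_cancel_iff) (intro mult_right_mono, auto)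
  also have "(2 * (1 + \<eta>) * M + (5 + 2 * real v)) * ln c = ln 4 * M + (\<beta> - \<delta> * M)"
  proof -
    have "ln 4 = 2 * ln (2 :: real)" using ln_realpow[of 2 2] by simp
    then show ?thesis by (simp add: \<beta>_def \<delta>_def algebra_simps)
  qed
  also have "exp (ln 4 * M + (\<beta> - \<delta> * M)) < 4 ^ M / (2 * M) - 1"
  proof -
    have e: "exp (ln 4 * M) = (4 :: real) ^ M" by (simp add: exp_of_nat2_mult mult.commute exp_of_nat_mult)
    have "4 ^ M * (2 * real M * exp (\<beta> - \<delta> * M) + 2 * real M * exp (- ln 4 * M)) < 4 ^ M * 1"
      using M(4) by (intro mult_strict_left_mono) auto
    moreover have "exp (- ln 4 * M) = 1 / (4 :: real) ^ M"
      using e by (simp add: exp_minus inverse_eq_divide)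
    moreover have "exp (ln 4 * M + (\<beta> - \<delta> * M)) = 4 ^ M * exp (\<beta> - \<delta> * M)"
      unfolding exp_add e ..
    ultimately show ?thesis using M(1) by (simp add: field_simps)
  qed
  also have "\<dots> \<le> real (2 * M choose M) - 1"
    using central_binomial_lower_bound[OF M(1)] by simp
  also have "\<dots> \<le> real ((2 * M choose M) - 1)" by simp
  finally have 3: "c ^ a < real ((2 * M choose M) - 1)" .
  show ?thesis using Rpos 1 2 3 unfolding a_def by (intro exI[of _ M] exI[of _ R]) simp
qed

theorem theorem3p2:
  fixes p c :: real
  assumes "0 < p" and "p < 1" and "1 < c" and "c < 2"
  shows "\<forall>\<^sub>F N in sequentially. \<exists>f. boolean_network N f \<and> biquadratic N f \<and> cooperative N f
           \<and> chaotic p c N f \<and> unstable p N f"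
proof -
  \<comment> \<open>The boot failures, the unbalanced blocks and the variables outside the blocks may each cost \<open>q\<close>.\<close>
  define q where "q = (1 - p) / 4"
  have q: "0 < q" "q < 1" "p = 1 - 4 * q" using assms by (simp_all add: q_def field_simps)
  obtain v0 :: nat where "(1 / 2) ^ v0 < q / 8"
    using real_arch_pow_inv[of "q / 8" "1 / 2"] q by auto
  define v where "v = Suc v0"
  have "(1 / 2) ^ v \<le> (1 / 2 :: real) ^ v0" unfolding v_def by (intro power_decreasing) auto
  with \<open>(1 / 2) ^ v0 < q / 8\<close> have v: "0 < v" "8 / 2 ^ v < q"
    by (auto simp: v_def power_one_over)
  obtain M R where R: "0 < R" "M / (2 * real R ^ 2) \<le> q"
    and frac: "(1 - q) * (2 * M + 2 * R + 3 + 2 * v) < 2 * M"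
    and base: "c ^ (2 * M + 2 * R + 3 + 2 * v) < real ((2 * M choose M) - 1)"
    using ex_block_size[OF assms(3,4) q(1,2), of v] by blast
  define a where "a = 2 * M + 2 * R + 3 + 2 * v"
  define w where "w = 2 * M + 2 * R + 5 + 2 * v"
  define S where "S = 2 + card (circuit_cells w)"
  define B where "B = real ((2 * M choose M) - 1)"
  have a: "0 < a" by (simp add: a_def)
  have "c ^ a < B" using base unfolding a_def B_def .
  moreover have "1 \<le> c ^ a" using assms(3) by (intro one_le_power) simp
  ultimately have B: "c ^ a < B" "1 < B" by linarith+
  have ca: "0 < c ^ a" using assms by simp
  define r where "r = B / c ^ a"
  have "1 < r" using B ca by (simp add: r_def)
  then have "filterlim (\<lambda>K. r ^ K) at_top sequentially" by real_asymp
  then have ev1: "\<forall>\<^sub>F K in sequentially. c ^ (a + S) * B ^ (5 * w + 4) < (B / c ^ a) ^ K"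
    unfolding filterlim_at_top_dense r_def by blast
  have ev2: "\<forall>\<^sub>F K in sequentially.
      ((1 - q) * (a + S) + 2 * M * (5 * w + 2)) / (2 * M - (1 - q) * a) \<le> real K"
    using filterlim_real_sequentially by (simp add: filterlim_at_top)
  have ev: "\<forall>\<^sub>F K in sequentially. 5 * w + 4 < K \<and>
      c ^ (a + S) * B ^ (5 * w + 4) < (B / c ^ a) ^ K \<and>
      ((1 - q) * (a + S) + 2 * M * (5 * w + 2)) / (2 * M - (1 - q) * a) \<le> real K"
    using ev1 ev2 eventually_gt_at_top[of "5 * w + 4"] by eventually_elim simp
  \<comment> \<open>The ring is made as long as \<open>N\<close> permits.\<close>
  have "filterlim (\<lambda>N. (N - S) div a) sequentially sequentially"
    unfolding filterlim_at_top
  proof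
    fix k
    show "\<forall>\<^sub>F N in sequentially. k \<le> (N - S) div a"
      using eventually_ge_at_top[of "S + k * a"]
      by eventually_elim (use a in \<open>simp add: less_eq_div_iff_mult_less_eq\<close>)
  qed
  from eventually_compose_filterlim[OF ev this] eventually_ge_at_top[of "Suc S"] show ?thesis
  proof eventually_elim
    case (elim N)
    define K where "K = (N - S) div a"
    have K: "5 * w + 4 < K" "c ^ (a + S) * B ^ (5 * w + 4) < (B / c ^ a) ^ K"
      "((1 - q) * (a + S) + 2 * M * (5 * w + 2)) / (2 * M - (1 - q) * a) \<le> real K"
      using elim by (simp_all add: K_def)
    have "a * K \<le> N - S" by (simp add: K_def)
    then have lo: "a * K + S \<le> N" using elim by simp
    have "N - S < a * K + a" using dividend_less_div_times[OF a, of "N - S"] by (simp add: K_def mult.commute)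
    then have hi: "N \<le> a * K + (a + S)" by simp
    have "c ^ N \<le> c ^ (a * K + (a + S))" using hi assms by (intro power_increasing) auto
    also have "\<dots> = (c ^ a) ^ K * c ^ (a + S)" by (simp only: power_add power_mult)
    finally have "c ^ N * B ^ (5 * w + 4) \<le> (c ^ a) ^ K * c ^ (a + S) * B ^ (5 * w + 4)"
      using B by (intro mult_right_mono) auto
    also have "\<dots> = (c ^ a) ^ K * (c ^ (a + S) * B ^ (5 * w + 4))" by (rule mult.assoc)
    also have "\<dots> < (c ^ a) ^ K * (B / c ^ a) ^ K"
      using K(2) ca by (intro mult_strict_left_mono) auto
    also have "\<dots> = B ^ K" using assms(3) by (simp flip: power_mult_distrib)
    also have "\<dots> = B ^ (K - 5 * w - 4) * B ^ (5 * w + 4)" using K(1) by (simp flip: power_add)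
    finally have 1: "c ^ N < B ^ (K - 5 * w - 4)" using B by (simp add: mult_less_cancel_right)
    have "0 < 2 * M - (1 - q) * a" using frac by (simp add: a_def)
    then have "(1 - q) * (a + S) + 2 * M * (5 * w + 2) \<le> (2 * M - (1 - q) * a) * K"
      using K(3) by (simp add: field_simps)
    then have "(1 - q) * (a * K + (a + S)) \<le> 2 * M * (real K - (5 * w + 2))"
      by (simp add: algebra_simps)
    also have "real K - (5 * w + 2) = real (K - 5 * w - 2)" using K(1) by simp
    finally have "(1 - q) * (a * K + (a + S)) \<le> real (2 * M * (K - 5 * w - 2))" by simp
    moreover have "(1 - q) * N \<le> (1 - q) * (a * K + (a + S))"
      using hi q by (intro mult_left_mono) (simp_all flip: of_nat_mult of_nat_add)
    ultimately have "1 - q \<le> real (2 * M * (K - 5 * w - 2)) / N"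
      using elim by (simp add: pos_le_divide_eq)
    moreover have "1 - 2 * q \<le> 1 - 8 / 2 ^ v - M / (2 * real R ^ 2)" using v R by simp
    ultimately have "(1 - q) * (1 - 2 * q)
        \<le> real (2 * M * (K - 5 * w - 2)) / N * (1 - 8 / 2 ^ v - M / (2 * real R ^ 2))"
      by (rule mult_mono) (use q assms in simp_all)
    moreover have "(1 - q) * (1 - 2 * q) = p + (q + 2 * (q * q))" using q(3) by (simp add: algebra_simps)
    moreover have "0 \<le> q + 2 * (q * q)" using q(1) by simp
    ultimately have 2: "p \<le> real (2 * M * (K - 5 * w - 2)) / N * (1 - 8 / 2 ^ v - M / (2 * real R ^ 2))"
      by linarith
    have "p < 1 - 8 / 2 ^ v" using v q by linarith
    with 1 2 show ?case
      using counter_network[of v R N M K c p] v(1) R(1) K(1) lo assms(3) elim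
      by (simp add: w_def a_def S_def B_def)
  qed
qed

end
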